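(* Let $f:\mathbb{B}^n\to\mathbb{B}^{N_1}$ and $g:\mathbb{B}^n\to\mathbb{B}^{N_2}$ be polynomial proper maps with the same source and with Hermitian invariant groups $\Gamma_f$ and $\Gamma_g$. Let $m$ be an integer larger than the degree of $f$, and fix $\theta\in(0,\frac{\pi}{2})$. Define a rational proper map $j(f,g)$ by $$j(f,g)=J_\theta(f,\,g\otimes z^{\otimes m})=\cos(\theta)\,f\oplus\sin(\theta)\,(g\otimes z^{\otimes m}).$$ Then $$\Gamma_{j(f,g)}\cap\mathbf{U}(n)=\Gamma_f\cap\Gamma_g\cap\mathbf{U}(n).$$
   Context: $\mathbb{B}^n$ is the open unit ball of $\mathbb{C}^n$, $\mathrm{Aut}(\mathbb{B}^n)$ is its group of holomorphic automorphisms, and $\mathbf{U}(n)\leqslant\mathrm{Aut}(\mathbb{B}^n)$ is the unitary group. For a rational proper map $f:\mathbb{B}^n\to\mathbb{B}^N$, the Hermitian invariant group is $$\Gamma_f=\{\gamma\in\mathrm{Aut}(\mathbb{B}^n):\ \text{there is } \psi\in\mathrm{Aut}(\mathbb{B}^N)\text{ with } f\circ\gamma=\psi\circ f\}.$$ $z^{\otimes m}$ is the $m$-fold tensor power of the identity map of $\mathbb{C}^n$, so $\|z^{\otimes m}\|^2=\|z\|^{2m}$; $g\otimes z^{\otimes m}$ is the pointwise tensor product of maps, and $\oplus$ is orthogonal sum. *)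

theory Defs
  imports "HOL-Analysis.Analysis"
begin

text \<open>
  Complex Euclidean space is \<open>complex^'n\<close>, whose norm is the Hermitian one, so that the open unit
  ball is \<open>ball 0 1\<close>.  Maps between balls are total functions of which only the values on
  \<open>ball 0 1\<close> are ever used.
\<close>

subsection \<open>Automorphisms and the unitary group\<close>

text \<open>Holomorphy on an open set \<open>S\<close>: the real Frechet derivative is given by a complex matrix.\<close>

definition holomorphic_map_on :: "(complex^'n \<Rightarrow> complex^'m) \<Rightarrow> (complex^'n) set \<Rightarrow> bool" where
  "holomorphic_map_on f S \<longleftrightarrow>
     (\<forall>z\<in>S. \<exists>A :: complex^'n^'m. (f has_derivative (\<lambda>v. A *v v)) (at z within S))"

text \<open>
  Automorphisms are extensional functions (equal to \<open>undefined\<close> off the ball), so that they are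
  determined by their values on the ball and equality of functions is equality of automorphisms.
\<close>

definition Aut_ball :: "(complex^'n \<Rightarrow> complex^'n) set" where
  "Aut_ball = {\<gamma> \<in> extensional (ball 0 1). bij_betw \<gamma> (ball 0 1) (ball 0 1) \<and>
     holomorphic_map_on \<gamma> (ball 0 1) \<and>
     holomorphic_map_on (inv_into (ball 0 1) \<gamma>) (ball 0 1)}"

definition conj_transpose :: "complex^'n^'m \<Rightarrow> complex^'m^'n" where
  "conj_transpose A = (\<chi> i j. cnj (A $ j $ i))"

definition unitary_matrix :: "complex^'n^'n \<Rightarrow> bool" where
  "unitary_matrix A \<longleftrightarrow> conj_transpose A ** A = mat 1 \<and> A ** conj_transpose A = mat 1"

definition unitary_group :: "(complex^'n \<Rightarrow> complex^'n) set" where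
  "unitary_group = {restrict (\<lambda>z. A *v z) (ball 0 1) | A. unitary_matrix A}"

definition hermitian_invariant_group ::
    "(complex^'n \<Rightarrow> complex^'k) \<Rightarrow> (complex^'n \<Rightarrow> complex^'n) set" where
  "hermitian_invariant_group f =
     {\<gamma> \<in> Aut_ball. \<exists>\<psi>\<in>Aut_ball. \<forall>z\<in>ball 0 1. f (\<gamma> z) = \<psi> (f z)}"

subsection \<open>Polynomial and rational proper maps\<close>

text \<open>
  A multi-index is a function \<open>\<alpha> :: 'n \<Rightarrow> nat\<close>, of total degree \<open>sum \<alpha> UNIV\<close>.  The index set below
  is finite, as it has to be for the sum to be meaningful.
\<close>

lemma finite_multi_indices: "finite {\<alpha> :: 'n::finite \<Rightarrow> nat. sum \<alpha> UNIV \<le> d}"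
proof (rule finite_subset)
  show "{\<alpha> :: 'n \<Rightarrow> nat. sum \<alpha> UNIV \<le> d} \<subseteq> (UNIV :: 'n set) \<rightarrow>\<^sub>E {..d}"
    by (auto simp: PiE_def Pi_def) (meson UNIV_I finite member_le_sum order_trans zero_le)
  show "finite ((UNIV :: 'n set) \<rightarrow>\<^sub>E {..d})"
    by (intro finite_PiE) auto
qed

definition polynomial_of_degree_le :: "nat \<Rightarrow> (complex^'n \<Rightarrow> complex) \<Rightarrow> bool" where
  "polynomial_of_degree_le d p \<longleftrightarrow>
     (\<exists>c :: ('n \<Rightarrow> nat) \<Rightarrow> complex. \<forall>z\<in>ball 0 1.
        p z = (\<Sum>\<alpha> | sum \<alpha> UNIV \<le> d. c \<alpha> * (\<Prod>i\<in>UNIV. (z $ i) ^ \<alpha> i)))"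

definition polynomial_map :: "(complex^'n \<Rightarrow> complex^'k) \<Rightarrow> bool" where
  "polynomial_map f \<longleftrightarrow> (\<exists>d. \<forall>k. polynomial_of_degree_le d (\<lambda>z. f z $ k))"

text \<open>The degree of a polynomial map: the maximal total degree of its components.\<close>

definition map_degree :: "(complex^'n \<Rightarrow> complex^'k) \<Rightarrow> nat" where
  "map_degree f = (LEAST d. \<forall>k. polynomial_of_degree_le d (\<lambda>z. f z $ k))"

text \<open>\<open>f = p / q\<close> on the ball with \<open>p\<close>, \<open>q\<close> polynomial and \<open>q\<close> zero-free there.\<close>

definition rational_map :: "(complex^'n \<Rightarrow> complex^'k) \<Rightarrow> bool" where
  "rational_map f \<longleftrightarrow>
     (\<exists>q p. (\<exists>d. polynomial_of_degree_le d q) \<and> polynomial_map p \<and>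
        (\<forall>z\<in>ball 0 1. q z \<noteq> 0 \<and> f z = (1 / q z) *s p z))"

text \<open>
  Since the ball is Hausdorff and locally compact, \<^const>\<open>proper_map\<close> between balls says precisely
  that preimages of compact sets are compact (theorem \<open>proper_eq_compact_map\<close>).
\<close>

definition proper_ball_map :: "(complex^'n \<Rightarrow> complex^'k) \<Rightarrow> bool" where
  "proper_ball_map f \<longleftrightarrow> proper_map (top_of_set (ball 0 1)) (top_of_set (ball 0 1)) f"

subsection \<open>Tensor products, tensor powers and orthogonal sums\<close>

definition vec_tensor :: "complex^'a \<Rightarrow> complex^'b \<Rightarrow> complex^('a::finite \<times> 'b::finite)"
    (infixr "\<otimes>\<^sub>v" 72) where
  "x \<otimes>\<^sub>v y = (\<chi> p. x $ fst p * y $ snd p)"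

text \<open>
  The \<open>m\<close>-fold tensor power, where \<open>m = CARD('m)\<close>: the space of \<open>m\<close>-tensors over \<open>complex^'n\<close> has
  the orthonormal basis \<open>e (\<phi> 1) \<otimes> \<dots> \<otimes> e (\<phi> m)\<close>, indexed by the functions \<open>\<phi> :: 'm \<Rightarrow> 'n\<close>.
\<close>

definition tensor_power :: "complex^'n \<Rightarrow> complex^('m::finite \<Rightarrow> 'n::finite)" where
  "tensor_power z = (\<chi> \<phi>. \<Prod>i\<in>UNIV. z $ \<phi> i)"

lemma norm_tensor_power:
  fixes z :: "complex^'n"
  shows "norm (tensor_power z :: complex^('m::finite \<Rightarrow> 'n)) = norm z ^ CARD('m)"
proof -
  have "(\<Sum>\<phi>\<in>UNIV. (norm (\<Prod>i\<in>(UNIV :: 'm set). z $ \<phi> i))\<^sup>2)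
      = (\<Sum>\<phi>\<in>(UNIV :: 'm set) \<rightarrow>\<^sub>E (UNIV :: 'n set). \<Prod>i\<in>UNIV. (norm (z $ \<phi> i))\<^sup>2)"
    by (intro sum.cong) (auto simp: prod_norm[symmetric] prod_power_distrib PiE_def)
  also have "\<dots> = (\<Prod>i\<in>(UNIV :: 'm set). \<Sum>k\<in>(UNIV :: 'n set). (norm (z $ k))\<^sup>2)"
    by (rule prod_sum_PiE[symmetric]) auto
  finally show ?thesis
    by (simp add: norm_vec_def L2_set_def tensor_power_def real_sqrt_power)
qed

definition vec_dsum :: "complex^'a \<Rightarrow> complex^'b \<Rightarrow> complex^('a::finite + 'b::finite)"
    (infixr "\<oplus>\<^sub>v" 65) where
  "x \<oplus>\<^sub>v y = (\<chi> s. case s of Inl a \<Rightarrow> x $ a | Inr b \<Rightarrow> y $ b)"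

definition J_map :: "real \<Rightarrow> (complex^'n \<Rightarrow> complex^'a) \<Rightarrow> (complex^'n \<Rightarrow> complex^'b) \<Rightarrow>
    complex^'n \<Rightarrow> complex^('a::finite + 'b::finite)" where
  "J_map \<theta> f g = (\<lambda>z. (cos \<theta> *\<^sub>R f z) \<oplus>\<^sub>v (sin \<theta> *\<^sub>R g z))"

end

theory Submission
  imports Defs "HOL-Complex_Analysis.Conformal_Mappings"
begin

text \<open>
  Everything rests on a description of the unitary invariants of a polynomial map \<open>f\<close> into a ball: a
  unitary \<open>A\<close> belongs to the Hermitian invariant group of \<open>f\<close> if and only if
  \<open>norm (f (A z)) = norm (f z)\<close> on the ball (\<open>unitary_mem_hermitian_invariant_group_iff\<close>).

  For the forward direction, let \<open>f (A z) = \<psi> (f z)\<close> with an automorphism \<open>\<psi>\<close>, and put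
  \<open>a = \<psi>\<inverse> 0\<close>.  Composing \<open>\<psi>\<close> with the Moebius involution that exchanges \<open>0\<close> and \<open>a\<close> gives a
  biholomorphism of the ball that fixes \<open>0\<close>, which preserves norms by the Schwarz lemma.  Hence
  \<open>(1 - \<bar>\<psi> w\<bar>\<^sup>2) \<bar>1 - \<langle>w, a\<rangle>\<bar>\<^sup>2 = (1 - \<bar>a\<bar>\<^sup>2) (1 - \<bar>w\<bar>\<^sup>2)\<close> (\<open>ball_biholomorphism_norm\<close>).
  Applying this to \<open>\<psi>\<close> at \<open>f z\<close> and to \<open>\<psi>\<inverse>\<close> at \<open>f (A z)\<close>, and multiplying, the factors
  \<open>1 - \<bar>f z\<bar>\<^sup>2\<close> and \<open>1 - \<bar>f (A z)\<bar>\<^sup>2\<close> cancel, and the product of the two holomorphic polynomials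
  \<open>1 - \<langle>f z, a\<rangle>\<close> and \<open>1 - \<langle>f (A z), b\<rangle>\<close>, where \<open>b = \<psi> 0\<close>, has constant modulus.  A product of
  polynomials that is a nonzero constant has constant factors, so \<open>1 - \<langle>f z, a\<rangle>\<close> is constant.
  At \<open>z = 0\<close>, which \<open>A\<close> fixes, the formula gives \<open>1 - \<bar>a\<bar>\<^sup>2\<close> for its squared modulus, and after
  cancelling this factor the formula at \<open>z\<close> says that the norms are equal.

  For the converse, polarization turns equality of norms into equality of all Hermitian products
  \<open>\<langle>f z, f w\<rangle> = \<langle>f (A z), f (A w)\<rangle>\<close> (\<open>polarization\<close>), and two families with the same Gram matrix
  differ by a unitary matrix (\<open>unitary_of_gram\<close>), which supplies \<open>\<psi>\<close>.

  The map \<open>j\<close> is itself polynomial and proper, so the criterion applies to \<open>f\<close>, \<open>g\<close> and \<open>j\<close>.  Since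
  \<open>\<bar>j z\<bar>\<^sup>2 = cos\<^sup>2 \<theta> \<bar>f z\<bar>\<^sup>2 + sin\<^sup>2 \<theta> \<bar>g z\<bar>\<^sup>2 \<bar>z\<bar>\<^bsup>2 m\<^esup>\<close>, it only remains to see that invariance of this
  sum under \<open>A\<close> forces invariance of both summands.  Along a real ray the change of the first summand
  is a polynomial of degree less than \<open>2 m\<close>, while that of the second is divisible by the power \<open>2 m\<close>
  of the parameter; they cancel only if both vanish (\<open>norm_sum_separates\<close>).
\<close>

section \<open>The Hermitian form\<close>

definition herm :: "complex^'n \<Rightarrow> complex^'n \<Rightarrow> complex" where
  "herm x y = (\<Sum>i\<in>UNIV. x $ i * cnj (y $ i))"

lemma herm_add_left: "herm (x + y) z = herm x z + herm y z"
  by (simp add: herm_def distrib_right sum.distrib)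

lemma herm_diff_left: "herm (x - y) z = herm x z - herm y z"
  by (simp add: herm_def left_diff_distrib sum_subtractf)

lemma herm_scale_left: "herm (c *s x) y = c * herm x y"
  by (simp add: herm_def sum_distrib_left mult.assoc)

lemma herm_add_right: "herm x (y + z) = herm x y + herm x z"
  by (simp add: herm_def distrib_left sum.distrib)

lemma herm_diff_right: "herm x (y - z) = herm x y - herm x z"
  by (simp add: herm_def right_diff_distrib sum_subtractf)

lemma herm_scale_right: "herm x (c *s y) = cnj c * herm x y"
  by (simp add: herm_def sum_distrib_left mult_ac)

lemma herm_zero [simp]: "herm 0 y = 0" "herm x 0 = 0"
  by (simp_all add: herm_def)

lemmas herm_linear = herm_add_left herm_diff_left herm_scale_left
  herm_add_right herm_diff_right herm_scale_right

lemma cnj_herm: "cnj (herm x y) = herm y x"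
  by (simp add: herm_def mult.commute)

lemma herm_self: "herm x x = of_real ((norm x)\<^sup>2)"
  by (simp add: herm_def norm_vec_def L2_set_def real_sqrt_pow2 sum_nonneg complex_norm_square
      flip: of_real_power)

lemma Re_herm: "Re (herm x y) = inner x y"
  by (simp add: herm_def inner_vec_def inner_complex_def)

lemma norm_herm_le: "norm (herm x y) \<le> norm x * norm y"
proof -
  have "norm (herm x y) \<le> (\<Sum>i\<in>UNIV. \<bar>norm (x $ i)\<bar> * \<bar>norm (y $ i)\<bar>)"
    unfolding herm_def by (rule order_trans[OF norm_sum]) (simp add: norm_mult)
  also have "\<dots> \<le> norm x * norm y"
    unfolding norm_vec_def by (rule L2_set_mult_ineq)
  finally show ?thesis .
qed

lemma norm_scale_vec: "norm (c *s x) = norm c * norm (x :: complex^'n)"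
  by (simp add: norm_vec_def norm_mult L2_set_right_distrib)

lemma herm_matrix_left: "herm (A *v x) y = herm x (conj_transpose A *v y)"
proof -
  have "herm (A *v x) y = (\<Sum>i\<in>UNIV. \<Sum>k\<in>UNIV. A $ i $ k * x $ k * cnj (y $ i))"
    by (simp add: herm_def matrix_vector_mult_def sum_distrib_right)
  also have "\<dots> = (\<Sum>k\<in>UNIV. \<Sum>i\<in>UNIV. A $ i $ k * x $ k * cnj (y $ i))"
    by (rule sum.swap)
  also have "\<dots> = herm x (conj_transpose A *v y)"
    by (simp add: herm_def matrix_vector_mult_def conj_transpose_def sum_distrib_left mult_ac)
  finally show ?thesis .
qed

lemma conj_transpose_conj_transpose [simp]: "conj_transpose (conj_transpose A) = A"
  by (simp add: conj_transpose_def vec_eq_iff)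

lemma conj_transpose_mult: "conj_transpose (A ** B) = conj_transpose B ** conj_transpose A"
  by (simp add: conj_transpose_def matrix_matrix_mult_def vec_eq_iff mult.commute)

lemma conj_transpose_one [simp]: "conj_transpose (mat 1) = mat 1"
  by (auto simp: conj_transpose_def mat_def vec_eq_iff)

lemma herm_matrix_unitary:
  assumes "unitary_matrix A"
  shows "herm (A *v x) (A *v y) = herm x y"
  using assms
  by (simp add: herm_matrix_left matrix_vector_mul_assoc unitary_matrix_def)

lemma norm_unitary:
  assumes "unitary_matrix A"
  shows "norm (A *v x) = norm x"
proof -
  have "herm (A *v x) (A *v x) = herm x x"
    by (rule herm_matrix_unitary[OF assms])
  then have "(norm (A *v x))\<^sup>2 = (norm x)\<^sup>2"
    by (metis herm_self of_real_eq_iff)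
  then show ?thesis
    by simp
qed

lemma unitary_conj_transpose: "unitary_matrix A \<Longrightarrow> unitary_matrix (conj_transpose A)"
  by (simp add: unitary_matrix_def)

lemma unitary_mult: "unitary_matrix A \<Longrightarrow> unitary_matrix B \<Longrightarrow> unitary_matrix (A ** B)"
  unfolding unitary_matrix_def conj_transpose_mult
  by (metis matrix_mul_assoc matrix_mul_rid)

lemma unitary_inverse:
  assumes "unitary_matrix A"
  shows "conj_transpose A *v (A *v x) = x" "A *v (conj_transpose A *v x) = x"
  using assms by (simp_all add: matrix_vector_mul_assoc unitary_matrix_def)

lemma unitary_matrixI:
  fixes A :: "complex^'n^'n"
  assumes "\<And>x y. herm (A *v x) (A *v y) = herm x y"
  shows "unitary_matrix A"
proof -
  have "(conj_transpose A ** A) *v y = y" for y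
  proof -
    let ?d = "(conj_transpose A ** A) *v y - y"
    have "herm ?d ?d = herm ?d ((conj_transpose A ** A) *v y) - herm ?d y"
      by (simp add: herm_linear)
    also have "\<dots> = 0"
      using assms[of ?d y] by (metis diff_self herm_matrix_left matrix_vector_mul_assoc)
    finally show ?thesis
      by (simp add: herm_self)
  qed
  then have "conj_transpose A ** A = mat 1"
    by (simp add: matrix_eq)
  then show ?thesis
    by (auto simp: unitary_matrix_def matrix_left_right_inverse)
qed

section \<open>Holomorphic discs and the Schwarz lemma\<close>

text \<open>
  The Schwarz lemma for the ball concerns only curves parametrized by the unit disc, and for these
  holomorphy can be expressed coordinatewise with the one-variable notion.
\<close>

definition holomorphic_disc :: "(complex \<Rightarrow> complex^'n) \<Rightarrow> bool" where
  "holomorphic_disc c \<longleftrightarrow> (\<forall>i. (\<lambda>\<zeta>. c \<zeta> $ i) holomorphic_on ball 0 1)"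

lemma vec_eq_sum_axis: "x = (\<Sum>i\<in>UNIV. (x $ i) *s axis i (1::complex))"
  by (simp add: vec_eq_iff axis_def if_distrib[of "\<lambda>t. _ * t"] cong: if_cong)

lemma holomorphic_disc_compose:
  assumes \<psi>: "holomorphic_map_on \<psi> (ball 0 1)" and c: "holomorphic_disc c"
    and into: "\<And>\<zeta>. \<zeta> \<in> ball 0 1 \<Longrightarrow> c \<zeta> \<in> ball 0 1"
  shows "holomorphic_disc (\<lambda>\<zeta>. \<psi> (c \<zeta>))"
  unfolding holomorphic_disc_def
proof
  fix k
  show "(\<lambda>\<zeta>. \<psi> (c \<zeta>) $ k) holomorphic_on ball 0 1"
    unfolding holomorphic_on_open[OF open_ball]
  proof
    fix \<zeta> :: complex
    assume \<zeta>: "\<zeta> \<in> ball 0 1"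
    have "\<exists>d. ((\<lambda>\<zeta>. c \<zeta> $ i) has_field_derivative d) (at \<zeta>)" for i
      using c \<zeta> by (auto simp: holomorphic_disc_def holomorphic_on_open)
    then obtain d where d: "\<And>i. ((\<lambda>\<zeta>. c \<zeta> $ i) has_field_derivative d i) (at \<zeta>)"
      by metis
    have "linear (\<lambda>t. t *s axis i (1::complex) :: complex^'a)" for i
      by (rule linearI) (simp_all add: vec_eq_iff algebra_simps)
    then have bl: "bounded_linear (\<lambda>t. t *s axis i (1::complex) :: complex^'a)" for i
      by (simp add: linear_conv_bounded_linear)
    have "((\<lambda>\<zeta>. \<Sum>i\<in>UNIV. (c \<zeta> $ i) *s axis i 1) has_derivative
        (\<lambda>h. \<Sum>i\<in>UNIV. (d i * h) *s axis i 1)) (at \<zeta>)"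
      using d by (intro has_derivative_sum bounded_linear.has_derivative[OF bl])
        (auto simp: has_field_derivative_def)
    also have "(\<lambda>\<zeta>. \<Sum>i\<in>UNIV. (c \<zeta> $ i) *s axis i 1) = c"
      by (rule ext) (rule vec_eq_sum_axis[symmetric])
    also have "(\<lambda>h. \<Sum>i\<in>UNIV. (d i * h) *s axis i 1) = (\<lambda>h. h *s (\<chi> i. d i))"
    proof
      fix h
      show "(\<Sum>i\<in>UNIV. (d i * h) *s axis i 1) = h *s (\<chi> i. d i)"
        using vec_eq_sum_axis[of "h *s (\<chi> i. d i)"] by (simp add: mult.commute)
    qed
    finally have dc: "(c has_derivative (\<lambda>h. h *s (\<chi> i. d i))) (at \<zeta>)" .
    obtain A where "(\<psi> has_derivative (\<lambda>v. A *v v)) (at (c \<zeta>) within ball 0 1)"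
      using \<psi> into[OF \<zeta>] unfolding holomorphic_map_on_def by blast
    then have "(\<psi> has_derivative (\<lambda>v. A *v v)) (at (c \<zeta>))"
      using into[OF \<zeta>] by (simp add: at_within_open[OF _ open_ball])
    from has_derivative_compose[OF dc this]
    have "((\<lambda>\<zeta>. \<psi> (c \<zeta>) $ k) has_derivative (\<lambda>h. (A *v (h *s (\<chi> i. d i))) $ k)) (at \<zeta>)"
      by (rule bounded_linear.has_derivative[OF bounded_linear_vec_nth])
    also have "(\<lambda>h. (A *v (h *s (\<chi> i. d i))) $ k) = (*) ((A *v (\<chi> i. d i)) $ k)"
      by (auto simp: vector_scalar_commute mult.commute)
    finally show "\<exists>f'. ((\<lambda>\<zeta>. \<psi> (c \<zeta>) $ k) has_field_derivative f') (at \<zeta>)"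
      by (auto simp: has_field_derivative_def)
  qed
qed

text \<open>
  Pairing with the unit vector in the direction of \<open>c \<zeta>\<close> loses nothing of the norm at \<open>\<zeta>\<close> and
  reduces the claim to the Schwarz lemma for a function from the disc to the disc.
\<close>

lemma Schwarz_disc:
  fixes c :: "complex \<Rightarrow> complex^'n"
  assumes c: "holomorphic_disc c" and "c 0 = 0"
    and into: "\<And>\<zeta>. \<zeta> \<in> ball 0 1 \<Longrightarrow> c \<zeta> \<in> ball 0 1" and \<zeta>: "\<zeta> \<in> ball 0 1"
  shows "norm (c \<zeta>) \<le> norm \<zeta>"
proof (cases "c \<zeta> = 0")
  case False
  define w where "w = complex_of_real (1 / norm (c \<zeta>)) *s c \<zeta>"
  have "norm w = 1"
    using False by (simp add: w_def norm_scale_vec norm_divide)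
  have "norm (herm (c \<zeta>) w) \<le> norm \<zeta>"
  proof (rule Schwarz_Lemma(1)[of "\<lambda>\<zeta>. herm (c \<zeta>) w"])
    show "(\<lambda>\<zeta>. herm (c \<zeta>) w) holomorphic_on ball 0 1"
      using c unfolding herm_def holomorphic_disc_def by (intro holomorphic_intros) auto
    show "norm (herm (c z) w) < 1" if "norm z < 1" for z
      using norm_herm_le[of "c z" w] into[of z] that \<open>norm w = 1\<close> by simp
  qed (use \<open>c 0 = 0\<close> \<zeta> in auto)
  moreover have "herm (c \<zeta>) w = norm (c \<zeta>)"
    using False by (simp add: w_def herm_scale_right herm_self power2_eq_square)
  ultimately show ?thesis
    by simp
qed simp

section \<open>Automorphisms of the ball\<close>

text \<open>
  The classical involution \<open>(a - P z - s (z - P z)) / (1 - \<langle>z, a\<rangle>)\<close>, where \<open>P\<close> is the orthogonal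
  projection to the line of \<open>a\<close>.  Because \<open>(1 - s) / \<bar>a\<bar>\<^sup>2 = 1 / (1 + s)\<close>, the numerator can be written
  without dividing by \<open>\<bar>a\<bar>\<close>, so that the formula also covers \<open>a = 0\<close>, where it gives \<open>- z\<close>.
\<close>

definition moebius_ball :: "complex^'n \<Rightarrow> complex^'n \<Rightarrow> complex^'n" where
  "moebius_ball a z =
     (let s = complex_of_real (sqrt (1 - (norm a)\<^sup>2)); t = herm z a
      in (1 / (1 - t)) *s ((1 - t / (1 + s)) *s a - s *s z))"

lemma one_minus_herm_nonzero:
  assumes "norm z < 1" "norm a < 1"
  shows "1 - herm z a \<noteq> 0"
proof
  assume "1 - herm z a = 0"
  then have "1 \<le> norm z * norm a"
    using norm_herm_le[of z a] by simp
  moreover have "norm z * norm a < 1 * 1"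
    by (rule mult_strict_mono') (use assms in auto)
  ultimately show False
    by simp
qed

text \<open>
  With \<open>N\<close> the numerator and \<open>1 - t\<close> the denominator, expanding \<open>\<langle>N, N\<rangle>\<close> and replacing \<open>\<bar>a\<bar>\<^sup>2\<close> by
  \<open>(1 - s) (1 + s)\<close> leaves \<open>\<bar>1 - t\<bar>\<^sup>2 - s\<^sup>2 (1 - \<bar>z\<bar>\<^sup>2)\<close>.
\<close>

lemma moebius_ball_norm:
  assumes "norm z < 1" "norm a < 1"
  shows "(1 - (norm (moebius_ball a z))\<^sup>2) * (norm (1 - herm z a))\<^sup>2
    = (1 - (norm a)\<^sup>2) * (1 - (norm z)\<^sup>2)"
proof -
  define s where "s = sqrt (1 - (norm a)\<^sup>2)"
  define t where "t = herm z a"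
  define N where "N = (1 - t / (1 + of_real s)) *s a - of_real s *s z"
  have "(norm a)\<^sup>2 < 1"
    using assms by (simp add: power_less_one_iff)
  then have s: "s > 0" "s\<^sup>2 = 1 - (norm a)\<^sup>2"
    by (simp_all add: s_def)
  have "(norm a)\<^sup>2 = (1 - s) * (1 + s)"
    using s(2) by (simp add: algebra_simps power2_eq_square)
  then have a2: "complex_of_real ((norm a)\<^sup>2) = (1 - of_real s) * (1 + of_real s)"
    by (simp only: of_real_mult of_real_add of_real_diff of_real_1)
  have s1: "1 + complex_of_real s \<noteq> 0"
    using s(1) by (metis add_pos_pos of_real_1 of_real_add of_real_eq_0_iff order_less_irrefl zero_less_one)
  have "herm a z = cnj t"
    by (simp add: t_def cnj_herm)
  define q where "q = 1 - t / (1 + complex_of_real s)"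
  have "herm N N = q * cnj q * herm a a - of_real s * q * cnj t - of_real s * cnj q * t
      + of_real s * of_real s * herm z z"
    unfolding N_def q_def[symmetric]
    by (simp add: herm_linear t_def \<open>herm a z = cnj t\<close>[unfolded t_def] algebra_simps)
  also have "\<dots> = (1 - t / (1 + of_real s)) * (1 - cnj t / (1 + of_real s))
        * ((1 - of_real s) * (1 + of_real s))
      - of_real s * (1 - t / (1 + of_real s)) * cnj t - of_real s * (1 - cnj t / (1 + of_real s)) * t
      + of_real s * of_real s * herm z z"
    by (simp only: herm_self[of a] a2) (simp add: q_def)
  also have "\<dots> = (1 - t) * (1 - cnj t) - of_real s * of_real s * (1 - herm z z)"
    using s1 by (simp add: divide_simps) (simp add: algebra_simps)
  also have "\<dots> = of_real ((norm (1 - t))\<^sup>2 - s\<^sup>2 * (1 - (norm z)\<^sup>2))"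
    using complex_norm_square[of "1 - t"] by (simp add: herm_self power2_eq_square)
  finally have N: "(norm N)\<^sup>2 = (norm (1 - t))\<^sup>2 - s\<^sup>2 * (1 - (norm z)\<^sup>2)"
    by (simp only: herm_self of_real_eq_iff)
  have "moebius_ball a z = (1 / (1 - t)) *s N"
    by (simp add: moebius_ball_def Let_def N_def s_def t_def)
  then have "norm (moebius_ball a z) = norm N / norm (1 - t)"
    by (simp add: norm_scale_vec norm_divide)
  then have "norm (moebius_ball a z) * norm (1 - t) = norm N"
    using one_minus_herm_nonzero[OF assms] by (simp add: t_def)
  then have "(norm (moebius_ball a z))\<^sup>2 * (norm (1 - t))\<^sup>2 = (norm N)\<^sup>2"
    by (metis power_mult_distrib)
  then have "(1 - (norm (moebius_ball a z))\<^sup>2) * (norm (1 - t))\<^sup>2 = s\<^sup>2 * (1 - (norm z)\<^sup>2)"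
    unfolding N by (simp add: left_diff_distrib)
  then show ?thesis
    by (simp only: s(2) t_def)
qed

lemma moebius_ball_into:
  assumes "norm z < 1" "norm a < 1"
  shows "norm (moebius_ball a z) < 1"
proof -
  have "0 < (1 - (norm a)\<^sup>2) * (1 - (norm z)\<^sup>2)"
    using assms by (intro mult_pos_pos) (simp_all add: power_less_one_iff)
  then have "0 < 1 - (norm (moebius_ball a z))\<^sup>2"
    unfolding moebius_ball_norm[OF assms, symmetric] by (simp add: zero_less_mult_iff)
  then show ?thesis
    by (simp add: power_less_one_iff)
qed

lemma moebius_ball_0: "moebius_ball a 0 = a"
  by (simp add: moebius_ball_def)


text \<open>
  The key value is \<open>1 - \<langle>w, a\<rangle> = s\<^sup>2 / (1 - t)\<close> for the image \<open>w\<close> of \<open>z\<close>; with it the coefficients of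
  \<open>a\<close> cancel and that of \<open>z\<close> becomes \<open>1\<close>.
\<close>

lemma moebius_ball_involution:
  assumes "norm z < 1" "norm a < 1"
  shows "moebius_ball a (moebius_ball a z) = z"
proof -
  define s where "s = complex_of_real (sqrt (1 - (norm a)\<^sup>2))"
  define t where "t = herm z a"
  have "(norm a)\<^sup>2 < 1"
    using assms by (simp add: power_less_one_iff)
  then have "sqrt (1 - (norm a)\<^sup>2) > 0"
    by simp
  then have s: "s \<noteq> 0" "1 + s \<noteq> 0"
    unfolding s_def
    by (simp, metis add_pos_pos of_real_1 of_real_add of_real_eq_0_iff order_less_irrefl zero_less_one)
  have t: "1 - t \<noteq> 0"
    using one_minus_herm_nonzero[OF assms] by (simp add: t_def)
  have "s * s = of_real (1 - (norm a)\<^sup>2)"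
    using \<open>(norm a)\<^sup>2 < 1\<close> by (simp add: s_def flip: of_real_mult)
  then have aa: "herm a a = (1 - s) * (1 + s)"
    by (simp add: herm_self algebra_simps)
  define w where "w = moebius_ball a z"
  have w: "w = (1 / (1 - t)) *s ((1 - t / (1 + s)) *s a - s *s z)"
    by (simp add: w_def moebius_ball_def Let_def s_def t_def)
  define u where "u = herm w a"
  have "u = (1 / (1 - t)) * ((1 - t / (1 + s)) * ((1 - s) * (1 + s)) - s * t)"
    by (simp only: u_def w herm_linear aa t_def[symmetric])
  also have "\<dots> = 1 - s * s / (1 - t)"
    using s t by (simp add: divide_simps) (simp add: algebra_simps)
  finally have u: "u = 1 - s * s / (1 - t)" .
  have "moebius_ball a w = (1 / (1 - u)) *s ((1 - u / (1 + s)) *s a - s *s w)"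
    by (simp add: moebius_ball_def Let_def s_def u_def)
  also have "\<dots> = z"
  proof -
    have "(1 / (1 - u)) * ((1 - u / (1 + s)) * x - s * ((1 / (1 - t)) * ((1 - t / (1 + s)) * x - s * y))) = y"
      for x y
    proof -
      have "(1 - u / (1 + s)) * x - s * ((1 / (1 - t)) * ((1 - t / (1 + s)) * x - s * y)) = s * s / (1 - t) * y"
        unfolding u using s t by (simp add: divide_simps) (simp add: algebra_simps)
      then show ?thesis
        using s t by (simp add: u)
    qed
    then show ?thesis
      unfolding w vec_eq_iff by (simp only: vector_smult_component vector_minus_component) simp
  qed
  finally show ?thesis
    by (simp add: w_def)
qed

lemma holomorphic_disc_moebius:
  assumes c: "holomorphic_disc c" and into: "\<And>\<zeta>. \<zeta> \<in> ball 0 1 \<Longrightarrow> c \<zeta> \<in> ball 0 1"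
    and a: "norm a < 1"
  shows "holomorphic_disc (\<lambda>\<zeta>. moebius_ball a (c \<zeta>))"
proof -
  have [holomorphic_intros]: "(\<lambda>\<zeta>. c \<zeta> $ i) holomorphic_on ball 0 1" for i
    using c by (simp add: holomorphic_disc_def)
  have [holomorphic_intros]: "(\<lambda>\<zeta>. herm (c \<zeta>) a) holomorphic_on ball 0 1"
    unfolding herm_def by (intro holomorphic_intros)
  have "1 - herm (c \<zeta>) a \<noteq> 0" if "\<zeta> \<in> ball 0 1" for \<zeta>
    using one_minus_herm_nonzero[of "c \<zeta>" a] into[OF that] a by simp
  then show ?thesis
    unfolding holomorphic_disc_def moebius_ball_def Let_def
    by (auto intro!: holomorphic_intros simp: divide_inverse simp del: right_minus_eq)
qed

lemma holomorphic_disc_line: "holomorphic_disc (\<lambda>\<zeta>. \<zeta> *s u)"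
  unfolding holomorphic_disc_def by (auto intro!: holomorphic_intros)

text \<open>
  Let \<open>\<phi>\<close> be the Moebius involution for \<open>a = \<psi>' 0\<close>.  The maps \<open>\<psi> \<circ> \<phi>\<close> and \<open>\<phi> \<circ> \<psi>'\<close> are inverse to each
  other and fix \<open>0\<close>, so by the Schwarz lemma neither increases norms.  Thus \<open>\<psi> w\<close> and \<open>\<phi> w\<close> have the
  same norm, and the identity for \<open>\<psi>\<close> is the one for \<open>\<phi>\<close>.
\<close>

lemma ball_biholomorphism_norm:
  fixes \<psi> \<psi>' :: "complex^'n \<Rightarrow> complex^'n"
  assumes hol: "holomorphic_map_on \<psi> (ball 0 1)" "holomorphic_map_on \<psi>' (ball 0 1)"
    and into: "\<And>z. z \<in> ball 0 1 \<Longrightarrow> \<psi> z \<in> ball 0 1" "\<And>z. z \<in> ball 0 1 \<Longrightarrow> \<psi>' z \<in> ball 0 1"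
    and inv: "\<And>z. z \<in> ball 0 1 \<Longrightarrow> \<psi>' (\<psi> z) = z" "\<And>z. z \<in> ball 0 1 \<Longrightarrow> \<psi> (\<psi>' z) = z"
    and w: "w \<in> ball 0 1"
  shows "(1 - (norm (\<psi> w))\<^sup>2) * (norm (1 - herm w (\<psi>' 0)))\<^sup>2
    = (1 - (norm (\<psi>' 0))\<^sup>2) * (1 - (norm w)\<^sup>2)"
proof -
  let ?a = "\<psi>' 0"
  have a: "norm ?a < 1"
    using into(2)[of 0] by simp
  \<comment> \<open>Schwarz lemma for self-maps of the ball, by restriction to the disc through \<open>z\<close>.\<close>
  have disc: "norm (h z) \<le> norm z"
    if h0: "h 0 = 0" and hb: "\<And>z. z \<in> ball 0 1 \<Longrightarrow> h z \<in> ball 0 1"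
      and hd: "\<And>u. norm u \<le> 1 \<Longrightarrow> holomorphic_disc (\<lambda>\<zeta>. h (\<zeta> *s u))" and z: "z \<in> ball 0 1"
    for h :: "complex^'n \<Rightarrow> complex^'n" and z
  proof (cases "z = 0")
    case False
    define u where "u = complex_of_real (1 / norm z) *s z"
    have u: "norm u = 1" "z = of_real (norm z) *s u"
      using False by (simp_all add: u_def norm_scale_vec norm_divide vector_smult_assoc)
    have "norm (h (of_real (norm z) *s u)) \<le> norm (complex_of_real (norm z))"
      by (rule Schwarz_disc[OF hd]) (use u z hb h0 in \<open>auto simp: norm_scale_vec\<close>)
    then show ?thesis
      by (simp flip: u(2))
  qed (simp add: h0)
  have line: "\<zeta> *s u \<in> ball 0 1" if "norm u \<le> 1" "\<zeta> \<in> ball 0 1" for \<zeta> and u :: "complex^'n"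
    using that mult_left_mono[of "norm u" 1 "norm \<zeta>"] by (simp add: norm_scale_vec)
  define v where "v = moebius_ball ?a w"
  have v: "v \<in> ball 0 1" "moebius_ball ?a v = w"
    using w a moebius_ball_into[of w ?a] moebius_ball_involution[of w ?a] by (simp_all add: v_def)
  have mb: "moebius_ball ?a z \<in> ball 0 1" if "z \<in> ball 0 1" for z
    using moebius_ball_into[of z ?a] that a by simp
  have "norm (\<psi> (moebius_ball ?a v)) \<le> norm v"
  proof (rule disc[where h = "\<lambda>z. \<psi> (moebius_ball ?a z)", OF _ _ _ v(1)])
    show "\<psi> (moebius_ball ?a 0) = 0"
      by (simp add: moebius_ball_0 inv)
    show "holomorphic_disc (\<lambda>\<zeta>. \<psi> (moebius_ball ?a (\<zeta> *s u)))" if "norm u \<le> 1" for u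
      using line[OF that] a
      by (intro holomorphic_disc_compose[OF hol(1)] holomorphic_disc_moebius holomorphic_disc_line)
        (auto simp: moebius_ball_into)
  qed (intro into(1) mb)
  moreover have "norm (moebius_ball ?a (\<psi>' (\<psi> w))) \<le> norm (\<psi> w)"
  proof (rule disc[where h = "\<lambda>z. moebius_ball ?a (\<psi>' z)", OF _ _ _ into(1)[OF w]])
    have "moebius_ball ?a ?a = moebius_ball ?a (moebius_ball ?a 0)"
      by (simp add: moebius_ball_0)
    then show "moebius_ball ?a (\<psi>' 0) = 0"
      using a by (simp add: moebius_ball_involution)
    show "holomorphic_disc (\<lambda>\<zeta>. moebius_ball ?a (\<psi>' (\<zeta> *s u)))" if "norm u \<le> 1" for u
      using line[OF that] a into(2)
      by (intro holomorphic_disc_compose[OF hol(2)] holomorphic_disc_moebius holomorphic_disc_line) auto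
  qed (intro into(2) mb)
  ultimately have "norm (\<psi> w) = norm (moebius_ball ?a w)"
    using inv(1)[OF w] v(2) by (simp add: v_def)
  then show ?thesis
    using moebius_ball_norm[of w ?a] w a by simp
qed

section \<open>Polynomial maps along complex lines\<close>

text \<open>
  All arguments about polynomials in several variables take place on complex affine lines, where
  the one-variable theory of degrees and roots applies.
\<close>

definition poly_along_lines :: "nat \<Rightarrow> (complex^'n \<Rightarrow> complex) \<Rightarrow> bool" where
  "poly_along_lines d h \<longleftrightarrow>
     (\<forall>a b. \<exists>p. degree p \<le> d \<and> (\<forall>\<zeta>. h (a + \<zeta> *s b) = poly p \<zeta>))"

lemma poly_along_lines_monomial:
  assumes "sum \<alpha> UNIV \<le> d"
  shows "poly_along_lines d (\<lambda>z. c * (\<Prod>i\<in>UNIV. (z $ i) ^ \<alpha> i))"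
  unfolding poly_along_lines_def
proof (intro allI)
  fix a b :: "complex^'a"
  let ?p = "smult c (\<Prod>i\<in>UNIV. [:a $ i, b $ i:] ^ \<alpha> i)"
  have "degree ?p \<le> degree (\<Prod>i\<in>UNIV. [:a $ i, b $ i:] ^ \<alpha> i)"
    by (rule degree_smult_le)
  also have "\<dots> \<le> (\<Sum>i\<in>UNIV. degree ([:a $ i, b $ i:] ^ \<alpha> i))"
    using degree_prod_sum_le[of UNIV "\<lambda>i. [:a $ i, b $ i:] ^ \<alpha> i"] by simp
  also have "\<dots> \<le> sum \<alpha> UNIV"
  proof (rule sum_mono)
    fix i
    have "degree ([:a $ i, b $ i:] ^ \<alpha> i) \<le> degree [:a $ i, b $ i:] * \<alpha> i"
      by (rule degree_power_le)
    also have "\<dots> \<le> 1 * \<alpha> i"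
      by (intro mult_right_mono) auto
    finally show "degree ([:a $ i, b $ i:] ^ \<alpha> i) \<le> \<alpha> i"
      by simp
  qed
  finally have "degree ?p \<le> d"
    using assms by simp
  moreover have "\<forall>\<zeta>. c * (\<Prod>i\<in>UNIV. ((a + \<zeta> *s b) $ i) ^ \<alpha> i) = poly ?p \<zeta>"
    by (simp add: poly_prod)
  ultimately show "\<exists>p. degree p \<le> d \<and>
      (\<forall>\<zeta>. c * (\<Prod>i\<in>UNIV. ((a + \<zeta> *s b) $ i) ^ \<alpha> i) = poly p \<zeta>)"
    by blast
qed

lemma poly_along_lines_sum:
  assumes "finite I" "\<And>i. i \<in> I \<Longrightarrow> poly_along_lines d (h i)"
  shows "poly_along_lines d (\<lambda>z. \<Sum>i\<in>I. h i z)"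
  unfolding poly_along_lines_def
proof (intro allI)
  fix a b
  have "\<forall>i\<in>I. \<exists>p. degree p \<le> d \<and> (\<forall>\<zeta>. h i (a + \<zeta> *s b) = poly p \<zeta>)"
    using assms(2) unfolding poly_along_lines_def by blast
  then obtain p where p: "\<forall>i\<in>I. degree (p i) \<le> d \<and> (\<forall>\<zeta>. h i (a + \<zeta> *s b) = poly (p i) \<zeta>)"
    by metis
  then have "degree (\<Sum>i\<in>I. p i) \<le> d \<and> (\<forall>\<zeta>. (\<Sum>i\<in>I. h i (a + \<zeta> *s b)) = poly (\<Sum>i\<in>I. p i) \<zeta>)"
    using assms(1) by (auto simp: poly_sum intro: degree_sum_le)
  then show "\<exists>q. degree q \<le> d \<and> (\<forall>\<zeta>. (\<Sum>i\<in>I. h i (a + \<zeta> *s b)) = poly q \<zeta>)"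
    by blast
qed

text \<open>
  A map given by polynomials on the ball may take arbitrary values elsewhere; replacing it by the
  polynomials themselves gives access to whole lines.
\<close>

lemma polynomial_extension:
  fixes f :: "complex^'n \<Rightarrow> complex^'k"
  assumes "\<forall>k. polynomial_of_degree_le d (\<lambda>z. f z $ k)"
  obtains F :: "complex^'n \<Rightarrow> complex^'k"
  where "\<And>z. z \<in> ball 0 1 \<Longrightarrow> F z = f z" "\<And>k. poly_along_lines d (\<lambda>z. F z $ k)"
    "continuous_on UNIV F"
proof -
  have "\<forall>k. \<exists>c. \<forall>z\<in>ball 0 1.
      f z $ k = (\<Sum>\<alpha> | sum \<alpha> UNIV \<le> d. c \<alpha> * (\<Prod>i\<in>UNIV. (z $ i) ^ \<alpha> i))"
    using assms unfolding polynomial_of_degree_le_def by simp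
  from choice[OF this] obtain c where c: "\<forall>k. \<forall>z\<in>ball 0 1.
      f z $ k = (\<Sum>\<alpha> | sum \<alpha> UNIV \<le> d. c k \<alpha> * (\<Prod>i\<in>UNIV. (z $ i) ^ \<alpha> i))"
    by blast
  define F :: "complex^'n \<Rightarrow> complex^'k" where
    "F = (\<lambda>z. \<chi> k. \<Sum>\<alpha> | sum \<alpha> UNIV \<le> d. c k \<alpha> * (\<Prod>i\<in>UNIV. (z $ i) ^ \<alpha> i))"
  show ?thesis
  proof (rule that[of F])
    show "F z = f z" if "z \<in> ball 0 1" for z
      using c that by (simp add: F_def vec_eq_iff)
    show "poly_along_lines d (\<lambda>z. F z $ k)" for k
      unfolding F_def vec_lambda_beta
      by (intro poly_along_lines_sum poly_along_lines_monomial finite_multi_indices) auto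
    show "continuous_on UNIV F"
      unfolding F_def by (intro continuous_intros)
  qed
qed

lemma poly_eq_of_infinite:
  fixes p q :: "complex poly"
  assumes "infinite S" "\<And>x. x \<in> S \<Longrightarrow> poly p x = poly q x"
  shows "p = q"
proof (rule ccontr)
  assume "p \<noteq> q"
  then have "finite {x. poly (p - q) x = 0}"
    by (intro poly_roots_finite) simp
  moreover have "S \<subseteq> {x. poly (p - q) x = 0}"
    using assms(2) by auto
  ultimately show False
    using assms(1) finite_subset by blast
qed

lemma infinite_small_reals:
  assumes "\<epsilon> > 0"
  shows "infinite (complex_of_real ` {0<..<\<epsilon>})"
  using assms by (simp add: finite_image_iff inj_on_def infinite_Ioo)

section \<open>Polarization\<close>

text \<open>
  The conjugated parameter in the second argument compensates the conjugation in the form, so that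
  the expression is holomorphic in \<open>\<zeta>\<close>.  For real \<open>\<zeta>\<close> and equal lines it is a squared norm.
\<close>

lemma poly_herm_lines:
  fixes F :: "complex^'n \<Rightarrow> complex^'k"
  assumes "\<And>k. poly_along_lines d (\<lambda>z. F z $ k)"
  shows "\<exists>p. degree p \<le> 2 * d \<and> (\<forall>\<zeta>. herm (F (a + \<zeta> *s b)) (F (a' + cnj \<zeta> *s b')) = poly p \<zeta>)"
proof -
  have "\<forall>k. \<exists>p. degree p \<le> d \<and> (\<forall>\<zeta>. F (a + \<zeta> *s b) $ k = poly p \<zeta>)"
    and "\<forall>k. \<exists>p. degree p \<le> d \<and> (\<forall>\<zeta>. F (a' + \<zeta> *s b') $ k = poly p \<zeta>)"
    using assms unfolding poly_along_lines_def by blast+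
  then obtain p q where
    p: "\<And>k. degree (p k) \<le> d" "\<And>k \<zeta>. F (a + \<zeta> *s b) $ k = poly (p k) \<zeta>" and
    q: "\<And>k. degree (q k) \<le> d" "\<And>k \<zeta>. F (a' + \<zeta> *s b') $ k = poly (q k) \<zeta>"
    by metis
  have "degree (\<Sum>k\<in>UNIV. p k * map_poly cnj (q k)) \<le> 2 * d"
  proof (rule degree_sum_le)
    fix k
    have "degree (p k * map_poly cnj (q k)) \<le> degree (p k) + degree (map_poly cnj (q k))"
      by (rule degree_mult_le)
    then show "degree (p k * map_poly cnj (q k)) \<le> 2 * d"
      using p(1)[of k] q(1)[of k] map_poly_degree_leq[of cnj "q k"] by linarith
  qed simp
  moreover have "herm (F (a + \<zeta> *s b)) (F (a' + cnj \<zeta> *s b'))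
      = poly (\<Sum>k\<in>UNIV. p k * map_poly cnj (q k)) \<zeta>" for \<zeta>
    by (simp add: herm_def poly_sum p(2) q(2))
  ultimately show ?thesis
    by blast
qed

text \<open>
  On the line from \<open>z\<close> to \<open>w\<close>, regard the Hermitian product of the values at the parameters \<open>\<zeta>\<close> and
  \<open>cnj \<xi>\<close> as a polynomial in \<open>\<zeta> = x + \<i> y\<close> and \<open>\<xi> = x - \<i> y\<close>.  For real \<open>x\<close> and \<open>y\<close> it is a squared
  norm, so the polynomials of \<open>F\<close> and \<open>G\<close> agree at small real \<open>x\<close>, \<open>y\<close>.  They therefore agree at all
  complex \<open>x\<close>, \<open>y\<close>, in particular where \<open>\<zeta> = 0\<close> and \<open>\<xi> = 1\<close>.
\<close>

lemma polarization:
  fixes F G :: "complex^'n \<Rightarrow> complex^'k"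
  assumes F: "\<And>k. poly_along_lines d (\<lambda>z. F z $ k)"
    and G: "\<And>k. poly_along_lines d (\<lambda>z. G z $ k)"
    and eq: "\<And>z. z \<in> ball 0 1 \<Longrightarrow> norm (F z) = norm (G z)"
    and z: "z \<in> ball 0 1"
  shows "herm (F z) (F w) = herm (G z) (G w)"
proof -
  define b where "b = w - z"
  define Q where "Q = (\<lambda>H :: complex^'n \<Rightarrow> complex^'k. \<lambda>x y.
      herm (H (z + (x + \<i> * y) *s b)) (H (z + cnj (x - \<i> * y) *s b)))"
  have Qx: "\<exists>p. \<forall>x. Q H x y = poly p x" if "\<And>k. poly_along_lines d (\<lambda>z. H z $ k)" for H y
  proof -
    have "z + (x + \<i> * y) *s b = (z + (\<i> * y) *s b) + x *s b"
      and "z + cnj (x - \<i> * y) *s b = (z - cnj (\<i> * y) *s b) + cnj x *s b" for x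
      by (simp_all add: vec_eq_iff algebra_simps)
    then show ?thesis
      unfolding Q_def using poly_herm_lines[OF that] by metis
  qed
  have Qy: "\<exists>p. \<forall>y. Q H x y = poly p y" if "\<And>k. poly_along_lines d (\<lambda>z. H z $ k)" for H x
  proof -
    have "z + (x + \<i> * y) *s b = (z + x *s b) + y *s (\<i> *s b)"
      and "z + cnj (x - \<i> * y) *s b = (z + cnj x *s b) + cnj y *s (\<i> *s b)" for y
      by (simp_all add: vec_eq_iff algebra_simps)
    then show ?thesis
      unfolding Q_def using poly_herm_lines[OF that] by metis
  qed
  \<comment> \<open>Real parameters this small stay inside the ball, where the norms are known to agree.\<close>
  have "\<exists>\<epsilon>>0. \<forall>\<zeta>. norm \<zeta> < \<epsilon> \<longrightarrow> z + \<zeta> *s b \<in> ball 0 1"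
  proof -
    define \<epsilon> where "\<epsilon> = (1 - norm z) / (1 + norm b)"
    have "\<epsilon> > 0"
      using z by (simp add: \<epsilon>_def add_pos_nonneg)
    moreover have "norm (z + \<zeta> *s b) < 1" if "norm \<zeta> < \<epsilon>" for \<zeta>
    proof -
      have "norm \<zeta> * norm b \<le> norm \<zeta> * (1 + norm b)"
        by (intro mult_left_mono) auto
      also have "\<dots> < 1 - norm z"
        using that by (simp add: \<epsilon>_def pos_less_divide_eq add_pos_nonneg)
      finally show ?thesis
        using norm_triangle_ineq[of z "\<zeta> *s b"] by (simp add: norm_scale_vec)
    qed
    ultimately show ?thesis
      by auto
  qed
  then obtain \<epsilon> where \<epsilon>: "\<epsilon> > 0" "\<And>\<zeta>. norm \<zeta> < \<epsilon> \<Longrightarrow> z + \<zeta> *s b \<in> ball 0 1"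
    by blast
  define S where "S = complex_of_real ` {0<..<\<epsilon> / 2}"
  have S: "infinite S"
    unfolding S_def using \<epsilon>(1) by (intro infinite_small_reals) simp
  have Q_real: "Q F x y = Q G x y" if "x \<in> S" "y \<in> S" for x y
  proof -
    have "norm (x + \<i> * y) \<le> norm x + norm y"
      using norm_triangle_ineq[of x "\<i> * y"] by (simp add: norm_mult)
    also have "\<dots> < \<epsilon>"
      using that by (auto simp: S_def)
    finally have "norm (F (z + (x + \<i> * y) *s b)) = norm (G (z + (x + \<i> * y) *s b))"
      using \<epsilon>(2) eq by blast
    moreover have "cnj (x - \<i> * y) = x + \<i> * y"
      using that by (auto simp: S_def)
    ultimately show ?thesis
      unfolding Q_def by (simp only: herm_self)
  qed
  have "Q F x y = Q G x y" if "y \<in> S" for x y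
  proof -
    obtain p where p: "\<And>x. Q F x y = poly p x"
      using Qx[OF F, of y] by blast
    obtain q where q: "\<And>x. Q G x y = poly q x"
      using Qx[OF G, of y] by blast
    have "p = q"
      using Q_real[OF _ that] by (intro poly_eq_of_infinite[OF S]) (simp flip: p q)
    then show ?thesis
      by (simp add: p q)
  qed
  note Q_real = this
  have "Q F x y = Q G x y" for x y
  proof -
    obtain p where p: "\<And>y. Q F x y = poly p y"
      using Qy[OF F, of x] by blast
    obtain q where q: "\<And>y. Q G x y = poly q y"
      using Qy[OF G, of x] by blast
    have "p = q"
      using Q_real by (intro poly_eq_of_infinite[OF S]) (simp flip: p q)
    then show ?thesis
      by (simp add: p q)
  qed
  \<comment> \<open>Solving \<open>x + \<i> y = 0\<close> and \<open>x - \<i> y = 1\<close> gives \<open>x = 1/2\<close> and \<open>y = \<i>/2\<close>.\<close>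
  moreover have "z + (1/2 + \<i> * (\<i>/2)) *s b = z" "z + cnj (1/2 - \<i> * (\<i>/2)) *s b = w"
    by (simp_all add: b_def)
  ultimately show ?thesis
    unfolding Q_def by metis
qed

section \<open>Unitary equivalence of families with the same Gram matrix\<close>

text \<open>
  The complex Householder reflection along \<open>v = x - y\<close>.  Mapping \<open>x\<close> to \<open>y\<close> determines the multiplier
  \<open>c = 1 / \<langle>x, v\<rangle>\<close>, and equality of the norms of \<open>x\<close> and \<open>y\<close> says that \<open>2 Re \<langle>x, v\<rangle> = \<bar>v\<bar>\<^sup>2\<close>, which is
  exactly the condition for the reflection to be unitary.  It fixes the orthogonal complement of \<open>v\<close>,
  which is why it can correct one vector without disturbing others in the induction below.
\<close>

lemma unitary_reflection:
  fixes x y :: "complex^'n"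
  assumes "norm x = norm y"
  obtains A where "unitary_matrix A" "A *v x = y" "\<And>u. herm u x = herm u y \<Longrightarrow> A *v u = u"
proof (cases "x = y")
  case True
  then show ?thesis
    by (intro that[of "mat 1"]) (simp_all add: unitary_matrix_def)
next
  case False
  define v where "v = x - y"
  have re: "2 * Re (herm x v) = (norm v)\<^sup>2"
    using assms
    by (simp add: v_def herm_diff_right Re_herm herm_self[of x] dot_norm_neg[of x y] field_simps)
  have "v \<noteq> 0"
    using False by (simp add: v_def)
  then have nz: "herm x v \<noteq> 0"
    using re by (auto simp: complex_eq_iff)
  define c where "c = 1 / herm x v"
  define A :: "complex^'n^'n" where
    "A = (\<chi> i j. (if i = j then 1 else 0) - c * v $ i * cnj (v $ j))"
  have A: "A *v u = u - (c * herm u v) *s v" for u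
  proof -
    have "(A *v u) $ i = (\<Sum>j\<in>UNIV. (if i = j then u $ j else 0) - c * v $ i * cnj (v $ j) * u $ j)" for i
      unfolding A_def matrix_vector_mult_def by (auto intro!: sum.cong simp: algebra_simps)
    also have "\<dots> i = u $ i - c * v $ i * herm u v" for i
      by (simp add: sum_subtractf herm_def sum_distrib_left mult_ac)
    finally show ?thesis
      by (simp add: vec_eq_iff mult_ac)
  qed
  have c: "c + cnj c = c * cnj c * herm v v"
  proof -
    have "herm x v + cnj (herm x v) = herm v v"
      using re by (simp add: complex_add_cnj herm_self)
    then show ?thesis
      using nz by (simp add: c_def field_simps)
  qed
  show ?thesis
  proof (rule that[of A])
    show "unitary_matrix A"
    proof (rule unitary_matrixI)
      fix u w
      have "herm (A *v u) (A *v w) = herm u w - herm u v * herm v w * (c + cnj c - c * cnj c * herm v v)"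
        by (simp add: A herm_linear cnj_herm algebra_simps)
      then show "herm (A *v u) (A *v w) = herm u w"
        by (simp add: c)
    qed
    show "A *v x = y"
      using nz by (simp add: A c_def v_def)
    show "A *v u = u" if "herm u x = herm u y" for u
      using that by (simp add: A v_def herm_diff_right)
  qed
qed

text \<open>
  Once \<open>A\<close> is right on \<open>I\<close>, the vectors \<open>A (X k)\<close> and \<open>Y k\<close> have the same norm and the same products
  with every \<open>Y i\<close>, so the reflection that moves the one to the other fixes all \<open>Y i\<close>.
\<close>

lemma unitary_of_finite_gram:
  fixes X Y :: "'i \<Rightarrow> complex^'n"
  assumes "finite I" "\<And>i j. i \<in> I \<Longrightarrow> j \<in> I \<Longrightarrow> herm (X i) (X j) = herm (Y i) (Y j)"
  shows "\<exists>A. unitary_matrix A \<and> (\<forall>i\<in>I. A *v X i = Y i)"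
  using assms
proof (induction I rule: finite_induct)
  case empty
  then show ?case
    by (auto intro!: exI[of _ "mat 1"] simp: unitary_matrix_def)
next
  case (insert k I)
  then obtain A where A: "unitary_matrix A" "\<And>i. i \<in> I \<Longrightarrow> A *v X i = Y i"
    by auto
  have gram: "herm (A *v X i) (A *v X k) = herm (Y i) (Y k)" if "i \<in> insert k I" for i
    using insert.prems[OF that, of k] by (simp add: herm_matrix_unitary[OF A(1)])
  have "norm (A *v X k) = norm (Y k)"
  proof -
    have "(norm (A *v X k))\<^sup>2 = (norm (Y k))\<^sup>2"
      using gram[of k] by (simp add: herm_self flip: of_real_power)
    then show ?thesis
      by simp
  qed
  then obtain B where B: "unitary_matrix B" "B *v (A *v X k) = Y k"
    "\<And>u. herm u (A *v X k) = herm u (Y k) \<Longrightarrow> B *v u = u"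
    by (rule unitary_reflection) blast
  have "B *v Y i = Y i" if "i \<in> I" for i
    using gram[of i] A(2)[OF that] that by (intro B(3)) simp
  then show ?case
    using A B by (intro exI[of _ "B ** A"]) (auto simp: unitary_mult simp flip: matrix_vector_mul_assoc)
qed

text \<open>
  A finite real basis extracted from the family determines \<open>A\<close>.  For any other index the error
  \<open>A (X i) - Y i\<close> is orthogonal to the image of the span, hence to \<open>A (X i)\<close>; as \<open>A (X i)\<close> and \<open>Y i\<close> have
  the same norm, the error vanishes.
\<close>

lemma unitary_of_gram:
  fixes X Y :: "'i \<Rightarrow> complex^'n"
  assumes gram: "\<And>i j. i \<in> I \<Longrightarrow> j \<in> I \<Longrightarrow> herm (X i) (X j) = herm (Y i) (Y j)"
  obtains A where "unitary_matrix A" "\<And>i. i \<in> I \<Longrightarrow> A *v X i = Y i"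
proof -
  obtain B where B: "B \<subseteq> X ` I" "independent B" "X ` I \<subseteq> span B"
    using maximal_independent_subset by blast
  have "finite B"
    using B(2) by (simp add: independent_bound)
  then obtain K where K: "K \<subseteq> I" "finite K" "B = X ` K"
    using B(1) finite_subset_image by metis
  then obtain A where A: "unitary_matrix A" "\<And>i. i \<in> K \<Longrightarrow> A *v X i = Y i"
    using unitary_of_finite_gram[of K X Y] gram by blast
  have "A *v X i = Y i" if i: "i \<in> I" for i
  proof -
    define D where "D = A *v X i - Y i"
    have "herm (A *v x) D = 0" if "x \<in> span B" for x
      using that
    proof (induction rule: span_induct_alt)
      case base
      then show ?case by simp
    next
      case (step r x y)
      then obtain k where k: "k \<in> K" "x = X k"
        using K(3) by blast
      have "herm (A *v x) D = 0"
        using k A(2)[OF k(1)] gram[of k i] i K(1)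
          herm_matrix_unitary[OF A(1), of "X k" "X i"] by (auto simp: D_def herm_diff_right)
      moreover have "r *\<^sub>R x = of_real r *s x"
        by (simp add: vec_eq_iff scaleR_conv_of_real[where 'a = complex])
      ultimately show ?case
        using step.IH by (simp add: matrix_vector_right_distrib vector_scalar_commute herm_linear)
    qed
    then have AD: "herm (A *v X i) D = 0"
      using B(3) i by blast
    moreover have "herm (A *v X i) (A *v X i) = herm (Y i) (Y i)"
      using gram[OF i i] by (simp add: herm_matrix_unitary[OF A(1)])
    moreover have "herm (Y i) D = 0"
    proof -
      have "herm (A *v X i) (Y i) = herm (Y i) (Y i)"
        using AD calculation by (simp add: D_def herm_diff_right)
      then have "herm (Y i) (A *v X i) = herm (Y i) (Y i)"
        by (metis cnj_herm)
      then show ?thesis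
        by (simp add: D_def herm_diff_right)
    qed
    ultimately have "herm D D = 0"
      by (subst D_def) (simp add: herm_diff_left)
    then show ?thesis
      by (simp add: D_def herm_self)
  qed
  with A(1) show ?thesis
    using that by blast
qed

section \<open>Which unitary maps are Hermitian invariants\<close>

lemma proper_ball_map_into:
  assumes "proper_ball_map f" "z \<in> ball 0 1"
  shows "f z \<in> ball 0 1"
  using assms closed_map_imp_subset_topspace unfolding proper_ball_map_def proper_map_def
  by fastforce

lemma poly_along_lines_matrix:
  assumes "poly_along_lines d h"
  shows "poly_along_lines d (\<lambda>z. h (A *v z))"
  using assms
  by (simp add: poly_along_lines_def matrix_vector_right_distrib vector_scalar_commute)

text \<open>
  The maximum modulus principle makes the product constant, and degrees add up in a product of nonzero
  polynomials.
\<close>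

lemma poly_factors_constant:
  fixes p q :: "complex poly"
  assumes "C > 0" "\<And>\<zeta>. norm \<zeta> < 1 \<Longrightarrow> norm (poly p \<zeta> * poly q \<zeta>) = C"
  shows "poly p \<zeta> = poly p 0"
proof -
  have "(\<lambda>\<zeta>. poly (p * q) \<zeta>) constant_on ball 0 1"
    using assms(2)
    by (intro maximum_modulus_principle[where U = "ball 0 1" and \<xi> = 0]) (auto intro!: holomorphic_intros)
  then obtain c where c: "\<And>\<zeta>. \<zeta> \<in> ball 0 1 \<Longrightarrow> poly (p * q) \<zeta> = c"
    unfolding constant_on_def by blast
  have "infinite (complex_of_real ` {0<..<1})"
    by (rule infinite_small_reals) simp
  then have "p * q = [:c:]"
    by (rule poly_eq_of_infinite) (use c in auto)
  moreover have "c \<noteq> 0"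
    using assms(1) assms(2)[of 0] c[of 0] by auto
  ultimately have "p * q \<noteq> 0" "degree (p * q) = 0"
    by auto
  then have "degree p = 0"
    by (auto simp: degree_mult_eq)
  then show ?thesis
    by (metis degree_eq_zeroE poly_pCons poly_0 mult_zero_right)
qed

lemma unitary_restrict_Aut:
  assumes "unitary_matrix A"
  shows "restrict (\<lambda>z. A *v z) (ball 0 1) \<in> Aut_ball"
proof -
  let ?\<gamma> = "restrict (\<lambda>z. A *v z) (ball 0 1)"
  let ?\<delta> = "restrict (\<lambda>z. conj_transpose A *v z) (ball 0 1)"
  have hol: "holomorphic_map_on (restrict (\<lambda>z. B *v z) (ball 0 1)) (ball 0 1)" for B :: "complex^'n^'n"
    unfolding holomorphic_map_on_def
  proof
    fix z :: "complex^'n"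
    assume z: "z \<in> ball 0 1"
    have "((\<lambda>z. B *v z) has_derivative (\<lambda>v. B *v v)) (at z within ball 0 1)"
      by (rule bounded_linear_imp_has_derivative) (rule matrix_vector_mul_bounded_linear)
    then have "(restrict (\<lambda>z. B *v z) (ball 0 1) has_derivative (\<lambda>v. B *v v)) (at z within ball 0 1)"
      by (rule has_derivative_transform[OF z, rotated]) simp
    then show "\<exists>A. (restrict (\<lambda>z. B *v z) (ball 0 1) has_derivative (\<lambda>v. A *v v)) (at z within ball 0 1)"
      by blast
  qed
  have bij: "bij_betw ?\<gamma> (ball 0 1) (ball 0 1)"
    by (rule bij_betw_byWitness[where f' = ?\<delta>])
      (auto simp: norm_unitary assms unitary_conj_transpose unitary_inverse)
  have "inv_into (ball 0 1) ?\<gamma> z = ?\<delta> z" if "z \<in> ball 0 1" for z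
  proof (rule inv_into_f_eq[OF bij_betw_imp_inj_on[OF bij]])
    show "?\<delta> z \<in> ball 0 1" "?\<gamma> (?\<delta> z) = z"
      using that by (auto simp: norm_unitary assms unitary_conj_transpose unitary_inverse)
  qed
  then have "holomorphic_map_on (inv_into (ball 0 1) ?\<gamma>) (ball 0 1)"
    using hol[of "conj_transpose A"] unfolding holomorphic_map_on_def
    by (metis (no_types, lifting) has_derivative_transform)
  then show ?thesis
    using hol bij by (simp add: Aut_ball_def)
qed

text \<open>
  The norm identity for automorphisms is used twice: for \<open>\<psi>\<close> at \<open>f z\<close> and for its inverse at
  \<open>f (A z)\<close>.  In their product everything but the polynomial \<open>1 - \<langle>f z, a\<rangle>\<close>, its counterpart for the
  inverse, and constants cancels.
\<close>

lemma invariant_imp_norm_eq: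
  fixes f :: "complex^'n \<Rightarrow> complex^'k"
  assumes poly: "polynomial_map f" and into: "\<And>z. z \<in> ball 0 1 \<Longrightarrow> f z \<in> ball 0 1"
    and A: "unitary_matrix A"
    and inv: "restrict (\<lambda>z. A *v z) (ball 0 1) \<in> hermitian_invariant_group f"
    and z: "z \<in> ball 0 1"
  shows "norm (f (A *v z)) = norm (f z)"
proof -
  obtain \<psi> where \<psi>: "\<psi> \<in> Aut_ball" "\<And>z. z \<in> ball 0 1 \<Longrightarrow> f (A *v z) = \<psi> (f z)"
    using inv by (auto simp: hermitian_invariant_group_def)
  define \<psi>' where "\<psi>' = inv_into (ball 0 1) \<psi>"
  have bij: "bij_betw \<psi> (ball 0 1) (ball 0 1)"
    and hol: "holomorphic_map_on \<psi> (ball 0 1)" "holomorphic_map_on \<psi>' (ball 0 1)"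
    using \<psi>(1) by (auto simp: Aut_ball_def \<psi>'_def)
  have maps: "\<psi> w \<in> ball 0 1" "\<psi>' w \<in> ball 0 1" "\<psi>' (\<psi> w) = w" "\<psi> (\<psi>' w) = w" if "w \<in> ball 0 1" for w
    using that bij bij_betw_inv_into[OF bij] unfolding \<psi>'_def
    by (blast intro: bij_betwE bij_betw_inv_into_left bij_betw_inv_into_right bij_betw_apply)+
  define a where "a = \<psi>' 0"
  define b where "b = \<psi> 0"
  have ab: "norm a < 1" "norm b < 1"
    using maps(1,2)[of 0] by (auto simp: a_def b_def)
  have fwd: "(1 - (norm (f (A *v z)))\<^sup>2) * (norm (1 - herm (f z) a))\<^sup>2
      = (1 - (norm a)\<^sup>2) * (1 - (norm (f z))\<^sup>2)" if "z \<in> ball 0 1" for z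
    unfolding a_def \<psi>(2)[OF that]
    by (rule ball_biholomorphism_norm[OF hol maps(1,2,3,4) into[OF that]])
  have bwd: "(1 - (norm (f z))\<^sup>2) * (norm (1 - herm (f (A *v z)) b))\<^sup>2
      = (1 - (norm b)\<^sup>2) * (1 - (norm (f (A *v z)))\<^sup>2)" if "z \<in> ball 0 1" for z
    using ball_biholomorphism_norm[OF hol(2,1) maps(2,1,4,3) maps(1)[OF into[OF that]]] that
    by (simp only: b_def \<psi>(2) maps(3) into)
  define C where "C = sqrt ((1 - (norm a)\<^sup>2) * (1 - (norm b)\<^sup>2))"
  have "C > 0"
    using ab by (simp add: C_def power_less_one_iff)
  have const: "norm ((1 - herm (f z) a) * (1 - herm (f (A *v z)) b)) = C" if z: "z \<in> ball 0 1" for z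
  proof -
    let ?r = "1 - (norm (f z))\<^sup>2" and ?s = "1 - (norm (f (A *v z)))\<^sup>2"
    have "A *v z \<in> ball 0 1"
      using z by (simp add: norm_unitary[OF A])
    then have "?r > 0" "?s > 0"
      using into[OF z] into[of "A *v z"] by (simp_all add: power_less_one_iff)
    then have nz: "?r \<noteq> 0" "?s \<noteq> 0"
      by simp_all
    have "(?r * ?s) * (norm ((1 - herm (f z) a) * (1 - herm (f (A *v z)) b)))\<^sup>2 = (?r * ?s) * C\<^sup>2"
    proof -
      have "C\<^sup>2 = (1 - (norm a)\<^sup>2) * (1 - (norm b)\<^sup>2)"
        unfolding C_def using ab by (intro real_sqrt_pow2 mult_nonneg_nonneg) (simp_all add: power_le_one)
      moreover have "(?s * (norm (1 - herm (f z) a))\<^sup>2) * (?r * (norm (1 - herm (f (A *v z)) b))\<^sup>2)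
          = ((1 - (norm a)\<^sup>2) * ?r) * ((1 - (norm b)\<^sup>2) * ?s)"
        by (simp only: fwd[OF z] bwd[OF z])
      ultimately show ?thesis
        by (simp only: norm_mult power_mult_distrib mult_ac)
    qed
    then have "(norm ((1 - herm (f z) a) * (1 - herm (f (A *v z)) b)))\<^sup>2 = C\<^sup>2"
      using nz by simp
    then show ?thesis
      using \<open>C > 0\<close> by (simp add: power2_eq_iff_nonneg)
  qed
  obtain d where "\<forall>k. polynomial_of_degree_le d (\<lambda>z. f z $ k)"
    using poly by (auto simp: polynomial_map_def)
  then obtain F where F: "\<And>z. z \<in> ball 0 1 \<Longrightarrow> F z = f z" "\<And>k. poly_along_lines d (\<lambda>z. F z $ k)"
    by (rule polynomial_extension) blast
  have line: "\<exists>p. \<forall>\<zeta>. 1 - herm (F (\<zeta> *s u)) v = poly p \<zeta>" for u v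
  proof -
    have "\<forall>k. \<exists>p. \<forall>\<zeta>. F (0 + \<zeta> *s u) $ k = poly p \<zeta>"
      using F(2) unfolding poly_along_lines_def by blast
    from choice[OF this] obtain p where "\<forall>k \<zeta>. F (0 + \<zeta> *s u) $ k = poly (p k) \<zeta>" ..
    then have "1 - herm (F (\<zeta> *s u)) v = poly (1 - (\<Sum>k\<in>UNIV. smult (cnj (v $ k)) (p k))) \<zeta>" for \<zeta>
      by (simp add: herm_def poly_sum mult.commute)
    then show ?thesis
      by blast
  qed
  obtain p where p: "\<And>\<zeta>. 1 - herm (F (\<zeta> *s z)) a = poly p \<zeta>"
    using line by blast
  obtain q where q: "\<And>\<zeta>. 1 - herm (F (\<zeta> *s (A *v z))) b = poly q \<zeta>"
    using line by blast
  have "norm (poly p \<zeta> * poly q \<zeta>) = C" if "norm \<zeta> < 1" for \<zeta>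
  proof -
    have "norm \<zeta> * norm z \<le> 1 * norm z"
      using that by (intro mult_right_mono) auto
    then have "\<zeta> *s z \<in> ball 0 1"
      using z by (simp add: norm_scale_vec)
    moreover from this have "A *v (\<zeta> *s z) \<in> ball 0 1"
      by (simp add: norm_unitary[OF A])
    ultimately show ?thesis
      using const[of "\<zeta> *s z"] by (simp add: F(1) vector_scalar_commute flip: p q)
  qed
  then have "poly p 1 = poly p 0"
    by (rule poly_factors_constant[OF \<open>C > 0\<close>])
  \<comment> \<open>Hence the line through \<open>0\<close> and \<open>z\<close> shows that the factor has the same value at \<open>z\<close> as at \<open>0\<close>.\<close>
  then have const_z: "1 - herm (f z) a = 1 - herm (f 0) a"
    using p[of 1] p[of 0] z by (simp add: F(1))
  have pos: "1 - (norm (f 0))\<^sup>2 > 0" "1 - (norm a)\<^sup>2 > 0"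
    using into[of 0] ab by (simp_all add: power_less_one_iff)
  \<comment> \<open>At the origin \<open>A 0 = 0\<close>, so both sides of the identity contain the same positive factor.\<close>
  have "(norm (1 - herm (f 0) a))\<^sup>2 = 1 - (norm a)\<^sup>2"
    using fwd[of 0] pos(1) by simp
  then have "1 - (norm (f (A *v z)))\<^sup>2 = 1 - (norm (f z))\<^sup>2"
    using fwd[OF z] pos(2) unfolding const_z by simp
  then show ?thesis
    by simp
qed

text \<open>
  Polarization and the comparison of Gram matrices produce a unitary \<open>U\<close> with \<open>f \<circ> A = U \<circ> f\<close>.
\<close>

lemma norm_eq_imp_invariant:
  fixes f :: "complex^'n \<Rightarrow> complex^'k"
  assumes poly: "polynomial_map f" and into: "\<And>z. z \<in> ball 0 1 \<Longrightarrow> f z \<in> ball 0 1"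
    and A: "unitary_matrix A"
    and eq: "\<And>z. z \<in> ball 0 1 \<Longrightarrow> norm (f (A *v z)) = norm (f z)"
  shows "restrict (\<lambda>z. A *v z) (ball 0 1) \<in> hermitian_invariant_group f"
proof -
  obtain d where "\<forall>k. polynomial_of_degree_le d (\<lambda>z. f z $ k)"
    using poly by (auto simp: polynomial_map_def)
  then obtain F where F: "\<And>z. z \<in> ball 0 1 \<Longrightarrow> F z = f z" "\<And>k. poly_along_lines d (\<lambda>z. F z $ k)"
    by (rule polynomial_extension) blast
  have Az: "A *v z \<in> ball 0 1" if "z \<in> ball 0 1" for z
    using that by (simp add: norm_unitary[OF A])
  have "herm (F z) (F w) = herm (F (A *v z)) (F (A *v w))" if "z \<in> ball 0 1" for z w
  proof (rule polarization[where G = "\<lambda>z. F (A *v z)", OF F(2) _ _ that])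
    show "poly_along_lines d (\<lambda>z. F (A *v z) $ k)" for k
      by (rule poly_along_lines_matrix[OF F(2)])
    show "norm (F z) = norm (F (A *v z))" if "z \<in> ball 0 1" for z
      using eq[OF that] F(1)[OF that] F(1)[OF Az[OF that]] by simp
  qed
  then have "herm (f z) (f w) = herm (f (A *v z)) (f (A *v w))"
    if "z \<in> ball 0 1" "w \<in> ball 0 1" for z w
    using that Az F(1) by metis
  then obtain U where U: "unitary_matrix U" "\<And>z. z \<in> ball 0 1 \<Longrightarrow> U *v f z = f (A *v z)"
    using unitary_of_gram[of "ball 0 1" f "\<lambda>z. f (A *v z)"] by blast
  show ?thesis
    unfolding hermitian_invariant_group_def
  proof (intro CollectI conjI bexI[of _ "restrict (\<lambda>w. U *v w) (ball 0 1)"] ballI)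
    show "f (restrict (\<lambda>z. A *v z) (ball 0 1) z) = restrict (\<lambda>w. U *v w) (ball 0 1) (f z)"
      if "z \<in> ball 0 1" for z
      using that into[OF that] U(2)[OF that] by simp
  qed (use A U in \<open>auto intro: unitary_restrict_Aut\<close>)
qed

lemma unitary_mem_hermitian_invariant_group_iff:
  assumes "polynomial_map f" "\<And>z. z \<in> ball 0 1 \<Longrightarrow> f z \<in> ball 0 1" "unitary_matrix A"
  shows "restrict (\<lambda>z. A *v z) (ball 0 1) \<in> hermitian_invariant_group f \<longleftrightarrow>
    (\<forall>z\<in>ball 0 1. norm (f (A *v z)) = norm (f z))"
  using assms invariant_imp_norm_eq norm_eq_imp_invariant by metis

section \<open>The join of two polynomial maps\<close>

lemma norm_vec_dsum:
  fixes x :: "complex^'a" and y :: "complex^'b"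
  shows "(norm (x \<oplus>\<^sub>v y))\<^sup>2 = (norm x)\<^sup>2 + (norm y)\<^sup>2"
proof -
  have "(\<Sum>s\<in>UNIV. h s) = (\<Sum>i\<in>UNIV. h (Inl i)) + (\<Sum>k\<in>UNIV. h (Inr k))"
    for h :: "'a + 'b \<Rightarrow> real"
    by (subst UNIV_Plus_UNIV[symmetric], subst sum.Plus) simp_all
  then show ?thesis
    by (simp add: norm_vec_def L2_set_def vec_dsum_def sum_nonneg)
qed

lemma norm_vec_tensor: "norm (x \<otimes>\<^sub>v y) = norm x * norm y"
proof -
  have "(\<Sum>p\<in>UNIV. (norm (x $ fst p * y $ snd p))\<^sup>2) = (\<Sum>i\<in>UNIV. (norm (x $ i))\<^sup>2) * (\<Sum>k\<in>UNIV. (norm (y $ k))\<^sup>2)"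
    by (simp add: sum_product sum.cartesian_product norm_mult power_mult_distrib case_prod_beta)
  then show ?thesis
    by (simp add: norm_vec_def L2_set_def vec_tensor_def real_sqrt_mult)
qed

lemma norm_J_tensor:
  fixes f :: "complex^'n \<Rightarrow> complex^'n1" and g :: "complex^'n \<Rightarrow> complex^'n2"
  shows "(norm (J_map \<theta> f (\<lambda>z. g z \<otimes>\<^sub>v (tensor_power z :: complex^('m::finite \<Rightarrow> 'n))) z))\<^sup>2
    = (cos \<theta>)\<^sup>2 * (norm (f z))\<^sup>2 + (sin \<theta>)\<^sup>2 * ((norm (g z))\<^sup>2 * norm z ^ (2 * CARD('m)))"
  by (simp add: J_map_def norm_vec_dsum norm_vec_tensor norm_tensor_power power_mult_distrib
      mult.commute[of 2] power_mult)

text \<open>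
  With \<open>z\<close> replaced by \<open>t z\<close>, the identity becomes \<open>R t = t\<^bsup>2 m\<^esup> S t\<close> for polynomials \<open>R\<close> and \<open>S\<close> that
  measure the change of the squared norms of \<open>f\<close> and of \<open>g\<close> under \<open>A\<close>.  Since \<open>R\<close> has degree at most
  \<open>2 d < 2 m\<close>, both vanish.
\<close>

lemma norm_sum_separates:
  fixes f :: "complex^'n \<Rightarrow> complex^'k" and g :: "complex^'n \<Rightarrow> complex^'l"
  assumes f: "\<forall>k. polynomial_of_degree_le d (\<lambda>z. f z $ k)" and g: "polynomial_map g"
    and "d < m" and A: "unitary_matrix A" and pos: "\<alpha> > 0" "\<beta> > 0"
    and eq: "\<And>z. z \<in> ball 0 1 \<Longrightarrow>
      \<alpha> * (norm (f (A *v z)))\<^sup>2 + \<beta> * ((norm (g (A *v z)))\<^sup>2 * norm z ^ (2 * m))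
      = \<alpha> * (norm (f z))\<^sup>2 + \<beta> * ((norm (g z))\<^sup>2 * norm z ^ (2 * m))"
    and z: "z \<in> ball 0 1"
  shows "norm (f (A *v z)) = norm (f z) \<and> norm (g (A *v z)) = norm (g z)"
proof (cases "z = 0")
  case False
  obtain F where F: "\<And>z. z \<in> ball 0 1 \<Longrightarrow> F z = f z" "\<And>k. poly_along_lines d (\<lambda>z. F z $ k)"
    using f by (rule polynomial_extension) blast
  obtain e where "\<forall>k. polynomial_of_degree_le e (\<lambda>z. g z $ k)"
    using g by (auto simp: polynomial_map_def)
  then obtain G where G: "\<And>z. z \<in> ball 0 1 \<Longrightarrow> G z = g z" "\<And>k. poly_along_lines e (\<lambda>z. G z $ k)"
    by (rule polynomial_extension) blast
  have ray: "\<exists>p. degree p \<le> 2 * d \<and> (\<forall>t. complex_of_real ((norm (H (of_real t *s u)))\<^sup>2) = poly p (of_real t))"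
    if "\<And>k. poly_along_lines d (\<lambda>z. H z $ k)" for d u and H :: "complex^'n \<Rightarrow> complex^'i"
    using poly_herm_lines[OF that, of 0 u 0 u] by (metis add_0 complex_cnj_complex_of_real herm_self)
  obtain f0 where f0: "degree f0 \<le> 2 * d"
      "\<And>t. complex_of_real ((norm (F (of_real t *s z)))\<^sup>2) = poly f0 (of_real t)"
    using ray[OF F(2)] by blast
  obtain f1 where f1: "degree f1 \<le> 2 * d"
      "\<And>t. complex_of_real ((norm (F (of_real t *s (A *v z))))\<^sup>2) = poly f1 (of_real t)"
    using ray[OF F(2)] by blast
  obtain g0 where g0: "\<And>t. complex_of_real ((norm (G (of_real t *s z)))\<^sup>2) = poly g0 (of_real t)"
    using ray[OF G(2)] by blast
  obtain g1 where g1: "\<And>t. complex_of_real ((norm (G (of_real t *s (A *v z))))\<^sup>2) = poly g1 (of_real t)"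
    using ray[OF G(2)] by blast
  define R where "R = smult (of_real \<alpha>) (f1 - f0)"
  define S where "S = smult (of_real (\<beta> * norm z ^ (2 * m))) (g0 - g1)"
  have "R = monom 1 (2 * m) * S"
  proof (rule poly_eq_of_infinite[OF infinite_small_reals[of 1]])
    fix x
    assume "x \<in> complex_of_real ` {0<..<1}"
    then obtain t where t: "0 < t" "t < 1" "x = of_real t"
      by auto
    have "t * norm z \<le> 1 * norm z"
      using t by (intro mult_right_mono) auto
    then have tz: "of_real t *s z \<in> ball 0 1"
      using z t by (simp add: norm_scale_vec)
    have Atz: "of_real t *s (A *v z) \<in> ball 0 1"
      using tz by (simp add: norm_scale_vec norm_unitary[OF A])
    have "norm (complex_of_real t *s z) ^ (2 * m) = t ^ (2 * m) * norm z ^ (2 * m)"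
      using t by (simp add: norm_scale_vec power_mult_distrib)
    then have "\<alpha> * ((norm (F (of_real t *s (A *v z))))\<^sup>2 - (norm (F (of_real t *s z)))\<^sup>2)
        = t ^ (2 * m) * (\<beta> * norm z ^ (2 * m)
          * ((norm (G (of_real t *s z)))\<^sup>2 - (norm (G (of_real t *s (A *v z))))\<^sup>2))"
      using eq[OF tz] F(1)[OF tz] F(1)[OF Atz] G(1)[OF tz] G(1)[OF Atz]
      by (simp add: vector_scalar_commute algebra_simps)
    then have "complex_of_real (\<alpha> * ((norm (F (of_real t *s (A *v z))))\<^sup>2 - (norm (F (of_real t *s z)))\<^sup>2))
        = complex_of_real (t ^ (2 * m) * (\<beta> * norm z ^ (2 * m)
          * ((norm (G (of_real t *s z)))\<^sup>2 - (norm (G (of_real t *s (A *v z))))\<^sup>2)))"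
      by (simp only:)
    then have "complex_of_real \<alpha> * (poly f1 x - poly f0 x)
        = x ^ (2 * m) * (complex_of_real (\<beta> * norm z ^ (2 * m)) * (poly g0 x - poly g1 x))"
      by (simp only: of_real_mult of_real_diff of_real_power[of t] f0(2) f1(2) g0 g1 t(3))
    then show "poly R x = poly (monom 1 (2 * m) * S) x"
      by (simp add: R_def S_def poly_monom)
  qed simp
  have "degree R \<le> 2 * d"
    unfolding R_def using f0(1) f1(1) by (intro degree_smult_le[THEN order_trans] degree_diff_le)
  have "S = 0"
  proof (rule ccontr)
    assume "S \<noteq> 0"
    then have "degree R = 2 * m + degree S"
      unfolding \<open>R = monom 1 (2 * m) * S\<close> by (subst degree_mult_eq) (simp_all add: degree_monom_eq)
    with \<open>degree R \<le> 2 * d\<close> \<open>d < m\<close> show False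
      by simp
  qed
  then have "R = 0"
    by (simp add: \<open>R = monom 1 (2 * m) * S\<close>)
  have "f1 = f0" "g1 = g0"
    using \<open>R = 0\<close> \<open>S = 0\<close> pos False by (simp_all add: R_def S_def)
  have Az: "A *v z \<in> ball 0 1"
    using z by (simp add: norm_unitary[OF A])
  have "(norm (f (A *v z)))\<^sup>2 = (norm (f z))\<^sup>2"
    using f0(2)[of 1] f1(2)[of 1] F(1)[OF z] F(1)[OF Az] \<open>f1 = f0\<close>
    by (metis of_real_1 of_real_eq_iff vector_smult_lid)
  moreover have "(norm (g (A *v z)))\<^sup>2 = (norm (g z))\<^sup>2"
    using g0[of 1] g1[of 1] G(1)[OF z] G(1)[OF Az] \<open>g1 = g0\<close>
    by (metis of_real_1 of_real_eq_iff vector_smult_lid)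
  ultimately show ?thesis
    by simp
qed simp

section \<open>Polynomial maps are closed under joins\<close>

lemma polynomial_of_degree_le_cong:
  assumes "\<And>z. z \<in> ball 0 1 \<Longrightarrow> p z = q z"
  shows "polynomial_of_degree_le d p = polynomial_of_degree_le d q"
  using assms by (simp add: polynomial_of_degree_le_def)

text \<open>
  Together with closure under finite sums this yields every other closure property: a product is
  expanded into monomials, without reindexing coefficients.
\<close>

lemma polynomial_monomial:
  assumes "sum \<beta> UNIV \<le> d"
  shows "polynomial_of_degree_le d (\<lambda>z :: complex^'n. c * (\<Prod>i\<in>UNIV. (z $ i) ^ \<beta> i))"
  unfolding polynomial_of_degree_le_def
proof (intro exI[of _ "\<lambda>\<alpha>. if \<alpha> = \<beta> then c else 0"] ballI)
  fix z :: "complex^'n"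
  have "(\<Sum>\<alpha> | sum \<alpha> UNIV \<le> d. (if \<alpha> = \<beta> then c else 0) * (\<Prod>i\<in>UNIV. (z $ i) ^ \<alpha> i))
      = (\<Sum>\<alpha> | sum \<alpha> UNIV \<le> d. if \<alpha> = \<beta> then c * (\<Prod>i\<in>UNIV. (z $ i) ^ \<beta> i) else 0)"
    by (intro sum.cong) auto
  also have "\<dots> = c * (\<Prod>i\<in>UNIV. (z $ i) ^ \<beta> i)"
    using assms by (subst sum.delta[OF finite_multi_indices]) simp
  finally show "c * (\<Prod>i\<in>UNIV. (z $ i) ^ \<beta> i)
      = (\<Sum>\<alpha> | sum \<alpha> UNIV \<le> d. (if \<alpha> = \<beta> then c else 0) * (\<Prod>i\<in>UNIV. (z $ i) ^ \<alpha> i))" ..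
qed

lemma polynomial_add:
  fixes p q :: "complex^'n \<Rightarrow> complex"
  assumes "polynomial_of_degree_le d p" "polynomial_of_degree_le d q"
  shows "polynomial_of_degree_le d (\<lambda>z. p z + q z)"
proof -
  obtain a b where
    "\<forall>z\<in>ball 0 1. p z = (\<Sum>\<alpha> | sum \<alpha> UNIV \<le> d. a \<alpha> * (\<Prod>i\<in>UNIV. (z $ i) ^ \<alpha> i))"
    "\<forall>z\<in>ball 0 1. q z = (\<Sum>\<alpha> | sum \<alpha> UNIV \<le> d. b \<alpha> * (\<Prod>i\<in>UNIV. (z $ i) ^ \<alpha> i))"
    using assms unfolding polynomial_of_degree_le_def by blast
  then show ?thesis
    unfolding polynomial_of_degree_le_def
    by (intro exI[of _ "\<lambda>\<alpha>. a \<alpha> + b \<alpha>"]) (simp add: distrib_right sum.distrib)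
qed

lemma polynomial_sum:
  fixes p :: "'i \<Rightarrow> complex^'n \<Rightarrow> complex"
  assumes "finite I" "\<And>i. i \<in> I \<Longrightarrow> polynomial_of_degree_le d (p i)"
  shows "polynomial_of_degree_le d (\<lambda>z. \<Sum>i\<in>I. p i z)"
  using assms
proof (induction I rule: finite_induct)
  case empty
  then show ?case
    by (auto simp: polynomial_of_degree_le_def intro!: exI[of _ "\<lambda>_. 0"])
qed (auto intro: polynomial_add)

lemma polynomial_mult:
  fixes p q :: "complex^'n \<Rightarrow> complex"
  assumes "polynomial_of_degree_le d p" "polynomial_of_degree_le e q"
  shows "polynomial_of_degree_le (d + e) (\<lambda>z. p z * q z)"
proof -
  obtain a b where
    a: "\<forall>z\<in>ball 0 1. p z = (\<Sum>\<alpha> | sum \<alpha> UNIV \<le> d. a \<alpha> * (\<Prod>i\<in>UNIV. (z $ i) ^ \<alpha> i))" and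
    b: "\<forall>z\<in>ball 0 1. q z = (\<Sum>\<beta> | sum \<beta> UNIV \<le> e. b \<beta> * (\<Prod>i\<in>UNIV. (z $ i) ^ \<beta> i))"
    using assms unfolding polynomial_of_degree_le_def by blast
  have "polynomial_of_degree_le (d + e) (\<lambda>z :: complex^'n. \<Sum>\<alpha> | sum \<alpha> UNIV \<le> d. \<Sum>\<beta> | sum \<beta> UNIV \<le> e.
      (a \<alpha> * b \<beta>) * (\<Prod>i\<in>UNIV. (z $ i) ^ (\<alpha> i + \<beta> i)))"
    by (intro polynomial_sum finite_multi_indices polynomial_monomial)
      (auto simp: sum.distrib add_mono)
  moreover have "p z * q z = (\<Sum>\<alpha> | sum \<alpha> UNIV \<le> d. \<Sum>\<beta> | sum \<beta> UNIV \<le> e.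
      (a \<alpha> * b \<beta>) * (\<Prod>i\<in>UNIV. (z $ i) ^ (\<alpha> i + \<beta> i)))" if "z \<in> ball 0 1" for z
    using a b that by (simp add: sum_product power_add prod.distrib mult_ac)
  ultimately show ?thesis
    using polynomial_of_degree_le_cong[of "\<lambda>z. p z * q z"] by simp
qed

lemma polynomial_const: "polynomial_of_degree_le d (\<lambda>z. c)"
  using polynomial_monomial[of "\<lambda>_. 0" d c] by simp

lemma polynomial_coord: "polynomial_of_degree_le 1 (\<lambda>z :: complex^'n. z $ k)"
proof -
  have "(\<Prod>i\<in>UNIV. (z $ i) ^ (if i = k then 1 else 0)) = z $ k" for z :: "complex^'n"
    by (subst prod.cong[OF refl, where h = "\<lambda>i. if i = k then z $ i else 1"]) (auto simp: prod.delta)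
  then show ?thesis
    using polynomial_monomial[of "\<lambda>i. if i = k then 1 else 0" 1 1] by simp
qed

lemma polynomial_prod:
  fixes p :: "'i \<Rightarrow> complex^'n \<Rightarrow> complex"
  assumes "finite I" "\<And>i. i \<in> I \<Longrightarrow> polynomial_of_degree_le 1 (p i)"
  shows "polynomial_of_degree_le (card I) (\<lambda>z. \<Prod>i\<in>I. p i z)"
  using assms
proof (induction I rule: finite_induct)
  case empty
  then show ?case
    by (simp add: polynomial_const)
next
  case (insert i I)
  then show ?case
    using polynomial_mult[of 1 "p i" "card I"] by simp
qed

text \<open>
  Multiplication by the constant \<open>1\<close>, seen as a polynomial of degree at most \<open>e - d\<close>, raises the bound.
\<close>

lemma polynomial_mono:
  fixes p :: "complex^'n \<Rightarrow> complex"
  assumes "polynomial_of_degree_le d p" "d \<le> e"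
  shows "polynomial_of_degree_le e p"
  using polynomial_mult[OF polynomial_const[of "e - d" 1] assms(1)] assms(2) by simp

lemma polynomial_map_J_tensor:
  fixes f :: "complex^'n \<Rightarrow> complex^'n1" and g :: "complex^'n \<Rightarrow> complex^'n2"
  assumes "polynomial_map f" "polynomial_map g"
  shows "polynomial_map (J_map \<theta> f (\<lambda>z. g z \<otimes>\<^sub>v (tensor_power z :: complex^('m::finite \<Rightarrow> 'n))))"
proof -
  obtain d e where d: "\<And>k. polynomial_of_degree_le d (\<lambda>z. f z $ k)"
    and e: "\<And>k. polynomial_of_degree_le e (\<lambda>z. g z $ k)"
    using assms by (auto simp: polynomial_map_def)
  \<comment> \<open>The summands \<open>0\<close> are the degrees of the constant factors \<open>cos \<theta>\<close> and \<open>sin \<theta>\<close>.\<close>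
  let ?D = "0 + d + (0 + (e + CARD('m)))"
  let ?j = "J_map \<theta> f (\<lambda>z. g z \<otimes>\<^sub>v (tensor_power z :: complex^('m \<Rightarrow> 'n)))"
  have "polynomial_of_degree_le ?D (\<lambda>z. ?j z $ k)" for k
  proof (cases k)
    case (Inl a)
    have "polynomial_of_degree_le (0 + d) (\<lambda>z. of_real (cos \<theta>) * f z $ a)"
      by (intro polynomial_mult polynomial_const d)
    then have "polynomial_of_degree_le ?D (\<lambda>z. of_real (cos \<theta>) * f z $ a)"
      by (rule polynomial_mono) simp
    then show ?thesis
      by (simp add: Inl J_map_def vec_dsum_def scaleR_conv_of_real[where 'a = complex])
  next
    case (Inr b)
    have "polynomial_of_degree_le (0 + (e + CARD('m)))
        (\<lambda>z. of_real (sin \<theta>) * (g z $ fst b * (\<Prod>i\<in>(UNIV :: 'm set). z $ snd b i)))"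
      by (intro polynomial_mult polynomial_const e polynomial_prod polynomial_coord) simp
    then have "polynomial_of_degree_le ?D
        (\<lambda>z. of_real (sin \<theta>) * (g z $ fst b * (\<Prod>i\<in>(UNIV :: 'm set). z $ snd b i)))"
      by (rule polynomial_mono) simp
    then show ?thesis
      by (simp add: Inr J_map_def vec_dsum_def vec_tensor_def tensor_power_def
          scaleR_conv_of_real[where 'a = complex])
  qed
  then show ?thesis
    unfolding polynomial_map_def by blast
qed

lemma polynomial_map_imp_rational_map:
  assumes "polynomial_map f"
  shows "rational_map f"
  unfolding rational_map_def
  using assms polynomial_const[of 0 1] by (intro exI[of _ "\<lambda>_. 1"] exI[of _ f]) auto

section \<open>Properness\<close>

lemma polynomial_map_continuous_on:
  assumes "polynomial_map f"
  shows "continuous_on (ball 0 1) f"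
proof -
  obtain d where "\<forall>k. polynomial_of_degree_le d (\<lambda>z. f z $ k)"
    using assms by (auto simp: polynomial_map_def)
  then obtain F where "\<And>z. z \<in> ball 0 1 \<Longrightarrow> F z = f z" "continuous_on UNIV F"
    by (rule polynomial_extension) blast
  then show ?thesis
    by (metis continuous_on_cong continuous_on_subset subset_UNIV)
qed

text \<open>
  A compact subset of the open ball lies in a closed ball of radius less than \<open>1\<close>, so it suffices to
  test properness on closed concentric balls.
\<close>

lemma proper_ball_map_iff:
  fixes f :: "complex^'n \<Rightarrow> complex^'k"
  assumes "continuous_on (ball 0 1) f"
  shows "proper_ball_map f \<longleftrightarrow> f ` ball 0 1 \<subseteq> ball 0 1 \<and>
    (\<forall>r<1. compact {z \<in> ball 0 1. norm (f z) \<le> r})"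
proof -
  have kc: "kc_space (top_of_set (ball 0 1 :: (complex^'k) set))"
    by (intro Hausdorff_imp_kc_space Hausdorff_space_subtopology) simp
  have k: "k_space (top_of_set (ball 0 1 :: (complex^'k) set))"
    by (intro metrizable_imp_k_space metrizable_space_subtopology) (simp add: metrizable_space_euclidean)
  show ?thesis
  proof (cases "f ` ball 0 1 \<subseteq> ball 0 1")
    case True
    then have "proper_ball_map f \<longleftrightarrow>
        (\<forall>K. compact K \<and> K \<subseteq> ball 0 1 \<longrightarrow> compact {z \<in> ball 0 1. f z \<in> K})"
      unfolding proper_ball_map_def using assms
      by (subst proper_eq_compact_map[OF k kc]) (auto simp: compactin_subtopology)
    also have "\<dots> \<longleftrightarrow> (\<forall>r<1. compact {z \<in> ball 0 1. norm (f z) \<le> r})"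
    proof (intro iffI allI impI)
      fix r :: real
      assume K: "\<forall>K. compact K \<and> K \<subseteq> ball 0 1 \<longrightarrow> compact {z \<in> ball 0 1. f z \<in> K}" and "r < 1"
      have "compact (cball (0 :: complex^'k) r) \<and> cball 0 r \<subseteq> ball (0 :: complex^'k) 1"
        using \<open>r < 1\<close> by auto
      with K have "compact {z \<in> ball 0 1. f z \<in> cball 0 r}"
        by blast
      then show "compact {z \<in> ball 0 1. norm (f z) \<le> r}"
        by simp
    next
      fix K :: "(complex^'k) set"
      assume r: "\<forall>r<1. compact {z \<in> ball 0 1. norm (f z) \<le> r}" and K: "compact K \<and> K \<subseteq> ball 0 1"
      have "\<exists>r<1. \<forall>w\<in>K. norm w \<le> r"
      proof (cases "K = {}")
        case False
        then obtain w where "w \<in> K" "\<And>v. v \<in> K \<Longrightarrow> norm v \<le> norm w"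
          using continuous_attains_sup[of K norm] K by (auto intro: continuous_intros)
        then show ?thesis
          using K by (intro exI[of _ "norm w"]) auto
      qed (auto intro: exI[of _ 0])
      then obtain r' where r': "r' < 1" "\<And>w. w \<in> K \<Longrightarrow> norm w \<le> r'"
        by blast
      let ?C = "{z \<in> ball 0 1. norm (f z) \<le> r'}"
      have "continuous_on ?C f"
        using assms by (rule continuous_on_subset) auto
      then have "closedin (top_of_set ?C) (?C \<inter> f -` K)"
        using K by (intro continuous_closedin_preimage) (auto simp: compact_imp_closed)
      then have "compact (?C \<inter> f -` K)"
        using r r'(1) closedin_compact by blast
      moreover have "?C \<inter> f -` K = {z \<in> ball 0 1. f z \<in> K}"
        using r'(2) by auto
      ultimately show "compact {z \<in> ball 0 1. f z \<in> K}"
        by simp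
    qed
    finally show ?thesis
      using True by simp
  next
    case False
    then show ?thesis
      using proper_ball_map_into[of f] by blast
  qed
qed

text \<open>
  The squared norm of \<open>j\<close> is a convex combination of those of \<open>f\<close> and of the tensor product.  Where it is
  at most \<open>s\<^sup>2\<close>, one of the two is, and in the second case one of the factors \<open>g z\<close> and \<open>\<bar>z\<bar>\<^sup>m\<close> is at most
  \<open>sqrt s\<close>.  Each of these three possibilities confines \<open>z\<close> to a compact subset of the ball.
\<close>

lemma proper_J_tensor:
  fixes f :: "complex^'n \<Rightarrow> complex^'n1" and g :: "complex^'n \<Rightarrow> complex^'n2"
    and j :: "complex^'n \<Rightarrow> complex^('n1 + 'n2 \<times> ('m::finite \<Rightarrow> 'n))"
  assumes f: "polynomial_map f" "proper_ball_map f" and g: "polynomial_map g" "proper_ball_map g"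
    and j: "j = J_map \<theta> f (\<lambda>z. g z \<otimes>\<^sub>v tensor_power z)"
  shows "proper_ball_map j"
proof -
  let ?m = "CARD('m)"
  have norm_j: "(norm (j z))\<^sup>2 = (cos \<theta>)\<^sup>2 * (norm (f z))\<^sup>2
      + (sin \<theta>)\<^sup>2 * ((norm (g z))\<^sup>2 * norm z ^ (2 * ?m))" for z
    unfolding j by (rule norm_J_tensor)
  have convex: "min a b \<le> (cos \<theta>)\<^sup>2 * a + (sin \<theta>)\<^sup>2 * b" "(cos \<theta>)\<^sup>2 * a + (sin \<theta>)\<^sup>2 * b \<le> max a b"
    for a b :: real
  proof -
    have "(cos \<theta>)\<^sup>2 * c + (sin \<theta>)\<^sup>2 * c = c" for c
      by (simp flip: distrib_right)
    moreover have "(cos \<theta>)\<^sup>2 * min a b + (sin \<theta>)\<^sup>2 * min a b \<le> (cos \<theta>)\<^sup>2 * a + (sin \<theta>)\<^sup>2 * b"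
      "(cos \<theta>)\<^sup>2 * a + (sin \<theta>)\<^sup>2 * b \<le> (cos \<theta>)\<^sup>2 * max a b + (sin \<theta>)\<^sup>2 * max a b"
      by (intro add_mono mult_left_mono; simp)+
    ultimately show "min a b \<le> (cos \<theta>)\<^sup>2 * a + (sin \<theta>)\<^sup>2 * b"
      "(cos \<theta>)\<^sup>2 * a + (sin \<theta>)\<^sup>2 * b \<le> max a b"
      by metis+
  qed
  have cont: "continuous_on (ball 0 1) f" "continuous_on (ball 0 1) g" "continuous_on (ball 0 1) j"
    unfolding j using f g by (simp_all add: polynomial_map_continuous_on polynomial_map_J_tensor)
  have comp: "compact {z \<in> ball 0 1. norm (f z) \<le> r}" "compact {z \<in> ball 0 1. norm (g z) \<le> r}"
    if "r < 1" for r
    using that f g proper_ball_map_iff[OF cont(1)] proper_ball_map_iff[OF cont(2)] by blast+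
  have into: "j z \<in> ball 0 1" if z: "z \<in> ball 0 1" for z
  proof -
    have "norm z ^ (2 * ?m) \<le> 1"
      using z by (simp add: power_le_one)
    then have "(norm (g z))\<^sup>2 * norm z ^ (2 * ?m) \<le> (norm (g z))\<^sup>2 * 1"
      by (intro mult_left_mono) auto
    moreover have "(norm (f z))\<^sup>2 < 1" "(norm (g z))\<^sup>2 < 1"
      using proper_ball_map_into[OF f(2) z] proper_ball_map_into[OF g(2) z]
      by (simp_all add: power_less_one_iff)
    ultimately have "(norm (j z))\<^sup>2 < 1"
      using convex(2)[of "(norm (f z))\<^sup>2" "(norm (g z))\<^sup>2 * norm z ^ (2 * ?m)"] by (simp add: norm_j)
    then show ?thesis
      by (simp add: power_less_one_iff)
  qed
  have "compact {z \<in> ball 0 1. norm (j z) \<le> r}" if r: "r < 1" for r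
  proof -
    define s where "s = max 0 r"
    have s: "0 \<le> s" "sqrt s < 1"
      using r by (simp_all add: s_def)
    let ?P = "{z \<in> ball 0 1. norm (f z) \<le> s}" and ?Q = "{z \<in> ball 0 1. norm (g z) \<le> sqrt s}"
      and ?R = "{z :: complex^'n. norm z ^ ?m \<le> sqrt s}"
    have R_ball: "?R \<subseteq> ball 0 1"
    proof
      fix z :: "complex^'n"
      assume "z \<in> ?R"
      with s(2) have "norm z ^ ?m < 1"
        by (metis le_less_trans mem_Collect_eq)
      then show "z \<in> ball 0 1"
        by (simp add: power_less_one_iff)
    qed
    have "bounded ?R"
      using R_ball bounded_ball bounded_subset by blast
    moreover have "closed ?R"
      by (intro closed_Collect_le continuous_intros)
    ultimately have "compact ?R"
      by (simp add: compact_eq_bounded_closed)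
    then have C: "compact (?P \<union> ?Q \<union> ?R)"
      using comp(1)[of s] comp(2)[OF s(2)] r by (intro compact_Un) (simp_all add: s_def)
    have sub: "{z \<in> ball 0 1. norm (j z) \<le> r} \<subseteq> ?P \<union> ?Q \<union> ?R"
    proof
      fix z
      assume z: "z \<in> {z \<in> ball 0 1. norm (j z) \<le> r}"
      then have "(norm (j z))\<^sup>2 \<le> s\<^sup>2"
        by (intro power_mono) (auto simp: s_def)
      then have "min ((norm (f z))\<^sup>2) ((norm (g z))\<^sup>2 * norm z ^ (2 * ?m)) \<le> s\<^sup>2"
        using convex(1)[of "(norm (f z))\<^sup>2" "(norm (g z))\<^sup>2 * norm z ^ (2 * ?m)"] by (simp add: norm_j)
      then have "(norm (f z))\<^sup>2 \<le> s\<^sup>2 \<or> (norm (g z) * norm z ^ ?m)\<^sup>2 \<le> s\<^sup>2"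
        by (simp add: min_le_iff_disj power_mult_distrib power_mult mult.commute[of 2])
      then have "norm (f z) \<le> s \<or> norm (g z) * norm z ^ ?m \<le> sqrt s * sqrt s"
        using s(1) by (auto dest: power2_le_imp_le)
      moreover have "sqrt s * sqrt s < norm (g z) * norm z ^ ?m"
        if "sqrt s < norm (g z)" "sqrt s < norm z ^ ?m"
        using that s(1) by (intro mult_strict_mono') auto
      ultimately show "z \<in> ?P \<union> ?Q \<union> ?R"
        using z by (auto simp: not_less[symmetric])
    qed
    have ball_sub: "?P \<union> ?Q \<union> ?R \<subseteq> ball 0 1"
      using R_ball by auto
    have "closedin (top_of_set (?P \<union> ?Q \<union> ?R)) ((?P \<union> ?Q \<union> ?R) \<inter> j -` cball 0 r)"
      by (intro continuous_closedin_preimage continuous_on_subset[OF cont(3) ball_sub]) simp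
    then have "compact ((?P \<union> ?Q \<union> ?R) \<inter> j -` cball 0 r)"
      by (rule closedin_compact[OF C])
    moreover have "(?P \<union> ?Q \<union> ?R) \<inter> j -` cball 0 r = {z \<in> ball 0 1. norm (j z) \<le> r}"
      using sub ball_sub by auto
    ultimately show ?thesis
      by simp
  qed
  then show ?thesis
    using into by (auto simp: proper_ball_map_iff[OF cont(3)])
qed

section \<open>Unitary invariants of the join\<close>

theorem proposition4p1:
  fixes f :: "complex^'n \<Rightarrow> complex^'n1"
    and g :: "complex^'n \<Rightarrow> complex^'n2"
    and m :: nat and \<theta> :: real
    and j :: "complex^'n \<Rightarrow> complex^('n1 + 'n2 \<times> ('m::finite \<Rightarrow> 'n))"
  assumes "polynomial_map f" and "proper_ball_map f"
    and "polynomial_map g" and "proper_ball_map g"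
    and "m = CARD('m)" and "m > map_degree f"
    and "0 < \<theta>" and "\<theta> < pi / 2"
    and "j = J_map \<theta> f (\<lambda>z. g z \<otimes>\<^sub>v tensor_power z)"
  shows "rational_map j \<and> proper_ball_map j \<and>
    hermitian_invariant_group j \<inter> unitary_group =
      hermitian_invariant_group f \<inter> hermitian_invariant_group g \<inter> unitary_group"
proof -
  have poly_j: "polynomial_map j"
    unfolding assms(9) by (rule polynomial_map_J_tensor[OF assms(1,3)])
  have proper_j: "proper_ball_map j"
    by (rule proper_J_tensor[OF assms(1-4,9)])
  have norm_j: "(norm (j z))\<^sup>2 = (cos \<theta>)\<^sup>2 * (norm (f z))\<^sup>2
      + (sin \<theta>)\<^sup>2 * ((norm (g z))\<^sup>2 * norm z ^ (2 * m))" for z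
    unfolding assms(5,9) by (rule norm_J_tensor)
  have pos: "(cos \<theta>)\<^sup>2 > 0" "(sin \<theta>)\<^sup>2 > 0"
    using assms(7,8) cos_gt_zero_pi[of \<theta>] sin_gt_zero[of \<theta>] by simp_all
  have deg_f: "\<forall>k. polynomial_of_degree_le (map_degree f) (\<lambda>z. f z $ k)"
    using assms(1) unfolding polynomial_map_def map_degree_def by (rule LeastI_ex)
  have iff: "\<gamma> \<in> hermitian_invariant_group j \<longleftrightarrow>
      \<gamma> \<in> hermitian_invariant_group f \<and> \<gamma> \<in> hermitian_invariant_group g"
    if \<gamma>: "\<gamma> \<in> unitary_group" for \<gamma>
  proof -
    obtain A where A: "unitary_matrix A" "\<gamma> = restrict (\<lambda>z. A *v z) (ball 0 1)"
      using \<gamma> by (auto simp: unitary_group_def)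
    have "(\<forall>z\<in>ball 0 1. norm (j (A *v z)) = norm (j z)) \<longleftrightarrow>
        (\<forall>z\<in>ball 0 1. norm (f (A *v z)) = norm (f z) \<and> norm (g (A *v z)) = norm (g z))"
    proof
      assume eq: "\<forall>z\<in>ball 0 1. norm (j (A *v z)) = norm (j z)"
      have "(cos \<theta>)\<^sup>2 * (norm (f (A *v z)))\<^sup>2 + (sin \<theta>)\<^sup>2 * ((norm (g (A *v z)))\<^sup>2 * norm z ^ (2 * m))
          = (cos \<theta>)\<^sup>2 * (norm (f z))\<^sup>2 + (sin \<theta>)\<^sup>2 * ((norm (g z))\<^sup>2 * norm z ^ (2 * m))"
        if "z \<in> ball 0 1" for z
        using norm_j[of "A *v z"] norm_j[of z] eq that by (simp add: norm_unitary[OF A(1)])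
      then show "\<forall>z\<in>ball 0 1. norm (f (A *v z)) = norm (f z) \<and> norm (g (A *v z)) = norm (g z)"
        using norm_sum_separates[OF deg_f assms(3,6) A(1) pos] by blast
    next
      assume eq: "\<forall>z\<in>ball 0 1. norm (f (A *v z)) = norm (f z) \<and> norm (g (A *v z)) = norm (g z)"
      show "\<forall>z\<in>ball 0 1. norm (j (A *v z)) = norm (j z)"
      proof
        fix z :: "complex^'n"
        assume "z \<in> ball 0 1"
        then have "(norm (j (A *v z)))\<^sup>2 = (norm (j z))\<^sup>2"
          using eq by (simp add: norm_j norm_unitary[OF A(1)])
        then show "norm (j (A *v z)) = norm (j z)"
          by simp
      qed
    qed
    moreover have "\<gamma> \<in> hermitian_invariant_group f \<longleftrightarrow> (\<forall>z\<in>ball 0 1. norm (f (A *v z)) = norm (f z))"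
      unfolding A(2)
      by (rule unitary_mem_hermitian_invariant_group_iff[OF assms(1) proper_ball_map_into[OF assms(2)] A(1)])
    moreover have "\<gamma> \<in> hermitian_invariant_group g \<longleftrightarrow> (\<forall>z\<in>ball 0 1. norm (g (A *v z)) = norm (g z))"
      unfolding A(2)
      by (rule unitary_mem_hermitian_invariant_group_iff[OF assms(3) proper_ball_map_into[OF assms(4)] A(1)])
    moreover have "\<gamma> \<in> hermitian_invariant_group j \<longleftrightarrow> (\<forall>z\<in>ball 0 1. norm (j (A *v z)) = norm (j z))"
      unfolding A(2)
      by (rule unitary_mem_hermitian_invariant_group_iff[OF poly_j proper_ball_map_into[OF proper_j] A(1)])
    ultimately show ?thesis
      by blast
  qed
  then have "hermitian_invariant_group j \<inter> unitary_group =
      hermitian_invariant_group f \<inter> hermitian_invariant_group g \<inter> unitary_group"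
    by blast
  then show ?thesis
    using polynomial_map_imp_rational_map[OF poly_j] proper_j by blast
qed

end
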